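(* For every $k\ge1$ there are weighted-homogeneous $\alpha_k,\beta_k\in\mathbb{Q}[a,b][\Delta^{-1}]$, of weights $3-5k$ and $2-5k$ respectively and independent of $\gamma$, such that $$Z_{2k}(\gamma)=\alpha_kA(\gamma)+\beta_kB(\gamma)\qquad\text{for every }\gamma\in H_1(E_{a,b},\mathbb{Z}).$$ Equivalently, $Z_{2k}=\mathsf{D}_kZ_0$ with $\mathsf{D}_k=2\beta_k\partial_a+2\alpha_k\partial_b$ a first-order operator regular away from $\Delta=0$.
   Context: $Q_0(x)=x^3+ax+b$ with $(a,b)\in\mathbb{C}^2$, $\Delta=4a^3+27b^2$, $E_{a,b}:y^2=Q_0(x)$ (with $\Delta\ne0$). Weights: $\mathrm{wt}(a)=2$, $\mathrm{wt}(b)=3$. Let $P=\sum_{k\ge0}\hbar^ks_k$ be the formal solution of the Riccati equation $Q_0=\hbar P'+P^2$ (prime $=d/dx$) with $s_0=\sqrt{Q_0}=y$; thus $s_1=-Q_0'/(4Q_0)$, $s_2=\frac{Q_0''}{8Q_0^{3/2}}-\frac{5Q_0'^2}{32Q_0^{5/2}}$, etc. Each $s_{2k}\,dx$ is a meromorphic form on $E_{a,b}$, and $Z_{2k}(\gamma)=\oint_\gamma s_{2k}\,dx$. Also $A(\gamma)=\oint_\gamma dx/y$, $B(\gamma)=\oint_\gamma x\,dx/y$, so that $A=2\partial_bZ_0$ and $B=2\partial_aZ_0$, with derivatives taken along locally constant $\gamma$. *)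

theory Defs
  imports
    "HOL-Analysis.Analysis"
    "HOL-Computational_Algebra.Polynomial"
    "HOL-Homology.Homology"
begin

definition cubic :: "complex \<Rightarrow> complex \<Rightarrow> complex \<Rightarrow> complex" where
  "cubic a b x = x ^ 3 + a * x + b"

definition disc :: "complex \<Rightarrow> complex \<Rightarrow> complex" where
  "disc a b = 4 * a ^ 3 + 27 * b ^ 2"

text \<open>The affine points of the elliptic curve. Adding the point at infinity does not
  change the first homology group, and the form \<open>y dx\<close> has a pole there.\<close>

definition curve :: "complex \<Rightarrow> complex \<Rightarrow> (complex \<times> complex) set" where
  "curve a b = {(x, y). y ^ 2 = cubic a b x}"


text \<open>The coefficients of the formal solution \<open>P = (\<Sum>k. \<hbar>^k s\<^sub>k)\<close> of
  \<open>Q\<^sub>0 = \<hbar> P' + P\<^sup>2\<close>, where \<open>r\<close> is a local branch of the square root of \<open>Q\<^sub>0\<close>: the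
  coefficient of \<open>\<hbar>^(n+1)\<close> reads
  \<open>0 = s\<^sub>n' + 2 s\<^sub>0 s\<^sub>n\<^sub>+\<^sub>1 + (\<Sum>i=1..n. s\<^sub>i s\<^sub>n\<^sub>+\<^sub>1\<^sub>-\<^sub>i)\<close>; see \<open>riccati_formal_solution\<close> below.\<close>

fun riccati :: "(complex \<Rightarrow> complex) \<Rightarrow> nat \<Rightarrow> complex \<Rightarrow> complex" where
  "riccati r 0 = r"
| "riccati r (Suc n) =
     (\<lambda>x. - (deriv (riccati r n) x + (\<Sum>i=1..n. riccati r i x * riccati r (Suc n - i) x))
            / (2 * r x))"

lemma riccati_formal_solution:
  assumes "r x ^ 2 = q" and "r x \<noteq> 0"
  shows "(\<Sum>i\<le>n. riccati r i x * riccati r (n - i) x)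
           + (if n = 0 then 0 else deriv (riccati r (n - 1)) x)
         = (if n = 0 then q else 0)"
proof (cases n)
  case 0
  then show ?thesis using assms by (simp add: power2_eq_square)
next
  case (Suc m)
  let ?S = "\<Sum>i=1..m. riccati r i x * riccati r (Suc m - i) x"
  have "{..Suc m} = insert 0 (insert (Suc m) {1..m})" by auto
  then have "(\<Sum>i\<le>Suc m. riccati r i x * riccati r (Suc m - i) x)
      = 2 * r x * riccati r (Suc m) x + ?S"
    by (simp del: riccati.simps(2))
  moreover have "2 * r x * riccati r (Suc m) x = - (deriv (riccati r m) x + ?S)"
    using assms(2) by simp
  ultimately show ?thesis using Suc by (simp del: riccati.simps(2))
qed

text \<open>\<open>wkb a b k (x, y)\<close> is the value of \<open>s\<^sub>k\<close> at the point \<open>(x, y)\<close> of the curve, with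
  \<open>y \<noteq> 0\<close>. The function \<open>\<xi> \<mapsto> y * csqrt (cubic a b \<xi> / y\<^sup>2)\<close> is, near \<open>x\<close>, the
  holomorphic square root of the cubic taking the value \<open>y\<close> at \<open>x\<close>.\<close>

definition wkb :: "complex \<Rightarrow> complex \<Rightarrow> nat \<Rightarrow> complex \<times> complex \<Rightarrow> complex" where
  "wkb a b k = (\<lambda>(x, y). riccati (\<lambda>\<xi>. y * csqrt (cubic a b \<xi> / y ^ 2)) k x)"


text \<open>A singular 1-simplex is parametrised by \<open>[0, 1]\<close> so that its boundary in the sense of
  \<open>chain_boundary\<close> is the end point minus the start point.\<close>

definition edge :: "((nat \<Rightarrow> real) \<Rightarrow> complex \<times> complex) \<Rightarrow> real \<Rightarrow> complex \<times> complex" where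
  "edge \<sigma> t = \<sigma> (\<lambda>i. if i = 0 then 1 - t else if i = 1 then t else 0)"

text \<open>The simplices along which the forms \<open>s\<^sub>k dx\<close> are integrated: piecewise continuously
  differentiable and avoiding the branch points, where these forms have poles.\<close>

definition smooth_simplex :: "complex \<Rightarrow> complex \<Rightarrow> ((nat \<Rightarrow> real) \<Rightarrow> complex \<times> complex) \<Rightarrow> bool" where
  "smooth_simplex a b \<sigma> \<longleftrightarrow>
     singular_simplex 1 (top_of_set (curve a b)) \<sigma> \<and> valid_path (edge \<sigma>) \<and>
     (\<forall>t\<in>{0..1}. snd (edge \<sigma> t) \<noteq> 0)"

definition smooth_cycle :: "complex \<Rightarrow> complex \<Rightarrow> (complex \<times> complex) chain \<Rightarrow> bool" where
  "smooth_cycle a b c \<longleftrightarrow>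
     singular_relcycle 1 (top_of_set (curve a b)) {} c \<and>
     (\<forall>\<sigma>\<in>Poly_Mapping.keys c. smooth_simplex a b \<sigma>)"

text \<open>The integral of the form \<open>f dx\<close>, first along a simplex, then along a chain.\<close>

definition simplex_integral ::
  "(complex \<times> complex \<Rightarrow> complex) \<Rightarrow> ((nat \<Rightarrow> real) \<Rightarrow> complex \<times> complex) \<Rightarrow> complex" where
  "simplex_integral f \<sigma> =
     integral {0..1} (\<lambda>t. f (edge \<sigma> t) * vector_derivative (fst \<circ> edge \<sigma>) (at t within {0..1}))"

definition chain_integral ::
  "(complex \<times> complex \<Rightarrow> complex) \<Rightarrow> (complex \<times> complex) chain \<Rightarrow> complex" where
  "chain_integral f c =
     (\<Sum>\<sigma>\<in>Poly_Mapping.keys c. of_int (Poly_Mapping.lookup c \<sigma>) * simplex_integral f \<sigma>)"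

definition Z :: "nat \<Rightarrow> complex \<Rightarrow> complex \<Rightarrow> (complex \<times> complex) chain \<Rightarrow> complex" where
  "Z k a b c = chain_integral (wkb a b k) c"

definition A_period :: "(complex \<times> complex) chain \<Rightarrow> complex" where
  "A_period c = chain_integral (\<lambda>(x, y). 1 / y) c"

definition B_period :: "(complex \<times> complex) chain \<Rightarrow> complex" where
  "B_period c = chain_integral (\<lambda>(x, y). x / y) c"


text \<open>A locally constant family of cycles around \<open>(a, b)\<close>: a cycle \<open>\<Gamma> a' b'\<close> on each nearby
  curve, whose simplices vary continuously with the parameters while their integer
  multiplicities stay fixed. The homology classes of such a family are the parallel
  transports of the class of \<open>\<Gamma> a b\<close>.\<close>

definition locally_constant_at ::
  "complex \<Rightarrow> complex \<Rightarrow> (complex \<Rightarrow> complex \<Rightarrow> (complex \<times> complex) chain) \<Rightarrow> bool" where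
  "locally_constant_at a b \<Gamma> \<longleftrightarrow>
     (\<exists>V c T. open V \<and> (a, b) \<in> V \<and> (\<forall>(a', b')\<in>V. disc a' b' \<noteq> 0) \<and>
        (\<forall>(a', b')\<in>V.
           \<Gamma> a' b' = frag_extend (\<lambda>\<sigma>. frag_of (T (a', b') \<sigma>)) c \<and>
           smooth_cycle a' b' (\<Gamma> a' b') \<and>
           (\<forall>\<sigma>\<in>Poly_Mapping.keys c. smooth_simplex a' b' (T (a', b') \<sigma>))) \<and>
        (\<forall>\<sigma>\<in>Poly_Mapping.keys (c :: (complex \<times> complex) chain).
           continuous_on (V \<times> {0..1}) (\<lambda>(p, t). edge (T p \<sigma>) t)))"


text \<open>Elements of \<open>\<rat>[a,b]\<close> are represented by polynomials in \<open>b\<close> over \<open>\<rat>[a]\<close>.\<close>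

definition eval_ab :: "rat poly poly \<Rightarrow> complex \<Rightarrow> complex \<Rightarrow> complex" where
  "eval_ab p a b = poly (map_poly (\<lambda>q. poly (map_poly of_rat q) a) p) b"

text \<open>The function given by a weighted-homogeneous element of weight \<open>w\<close> of
  \<open>\<rat>[a,b][\<Delta>\<^sup>-\<^sup>1]\<close>, where \<open>a\<close> has weight 2, \<open>b\<close> has weight 3 and hence \<open>\<Delta>\<close> has weight 6:
  it is \<open>p / \<Delta>^m\<close> with all monomials of \<open>p\<close> of weight \<open>w + 6 m\<close>.\<close>

definition weighted_homogeneous :: "int \<Rightarrow> (complex \<Rightarrow> complex \<Rightarrow> complex) \<Rightarrow> bool" where
  "weighted_homogeneous w f \<longleftrightarrow>
     (\<exists>p m. (\<forall>i j. Polynomial.coeff (Polynomial.coeff p j) i \<noteq> 0 \<longrightarrow> 2 * int i + 3 * int j = w + 6 * int m) \<and>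
            f = (\<lambda>a b. eval_ab p a b / disc a b ^ m))"

text \<open>The operator \<open>2 \<beta> \<partial>\<^sub>a + 2 \<alpha> \<partial>\<^sub>b\<close>.\<close>

definition D_op ::
  "(complex \<Rightarrow> complex \<Rightarrow> complex) \<Rightarrow> (complex \<Rightarrow> complex \<Rightarrow> complex) \<Rightarrow>
   (complex \<Rightarrow> complex \<Rightarrow> complex) \<Rightarrow> complex \<Rightarrow> complex \<Rightarrow> complex" where
  "D_op \<alpha> \<beta> F a b =
     2 * \<beta> a b * deriv (\<lambda>a'. F a' b) a + 2 * \<alpha> a b * deriv (\<lambda>b'. F a b') b"

end

(*
  On y^2 = Q(x) the coefficient s_{2k} equals F(x) / y^(6k-1) with F a polynomial, weighted
  homogeneous in a, b, x. Hermite reduction, driven by the Bezout identity U Q + V Q' = Delta,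
  writes F / y^(6k-1) dx as (alpha + beta x) dx / y plus an exact form, and exact forms integrate
  to zero over cycles.

  For the derivatives of Z_0 the simplices of the family vary only continuously with the
  parameter, so one cannot differentiate under the integral sign along them. Locally the integral
  of y dx along a moving edge is the integral along a fixed segment, which depends holomorphically
  on the parameter, plus two correction terms determined by the end points of the edge. The
  corrections telescope along an edge and cancel over a cycle.
*)
theory Submission
  imports Defs "HOL-Complex_Analysis.Complex_Analysis"
begin

text \<open>The derivative of \<open>Z 0\<close> is the delicate half. The chain \<open>c\<close> in
  \<open>locally_constant_at\<close> merely indexes simplices; only its images on the curves are
  assumed closed. A correction involves both the displaced and the original end point, so it is a
  function on the displaced curve only once equal displaced end points come from equal original
  ones. For small displacements they do, since finitely many distinct points moving continuously
  stay distinct for a while.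

  The algebraic half works with functions of \<open>(a, b)\<close> and never divides by the
  discriminant: each lowering of the pole multiplies by it instead. The only divisions are by
  rational numbers \<open>m + 3/2\<close> and \<open>j + 1/2\<close>, nonzero because
  \<open>y\<close> occurs to odd powers in the coefficients of even index. There are
  \<open>3 k - 1\<close> lowerings, from \<open>y^(6 k - 1)\<close> down to \<open>y\<close>. Each
  raises the weight of the numerator by 3 and that of the denominator by 6, so the weight
  \<open>4 k\<close> of the initial numerator becomes
  \<open>4 k - 3 (3 k - 1) = 3 - 5 k\<close>.\<close>

section \<open>Periods along moving edges\<close>

text \<open>The root of \<open>v\<close> continued from the value \<open>w\<close> at
  \<open>w^2\<close>. Dividing by \<open>w^2\<close> moves the base point to 1, away from the cut of
  the principal root; \<open>wkb\<close> is built from the same expression.\<close>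

definition branch :: "complex \<Rightarrow> complex \<Rightarrow> complex" where
  "branch w v = w * csqrt (v / w ^ 2)"

lemma branch_square: "w \<noteq> 0 \<Longrightarrow> branch w v ^ 2 = v"
  by (simp add: branch_def power_mult_distrib)

text \<open>The two roots of \<open>v\<close> differ by a sign, and the principal one is recognised
  by its quotient by \<open>w\<close> lying in the right half plane.\<close>

lemma branch_eqI:
  assumes "w \<noteq> 0" "s ^ 2 = v" "0 < Re (s / w)"
  shows "branch w v = s"
proof -
  have "csqrt (v / w ^ 2) = s / w"
    using assms by (intro csqrt_unique) (auto simp: power_divide)
  then show ?thesis using assms by (simp add: branch_def)
qed

lemma branch_self: "w \<noteq> 0 \<Longrightarrow> branch w (w ^ 2) = w"
  by (rule branch_eqI) auto

text \<open>With \<open>c\<close> the principal root, \<open>c^2 - 1 = (c - 1) (c + 1)\<close>, and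
  \<open>norm (c + 1)\<close> is at least 1 since \<open>Re c\<close> is nonnegative. A principal
  root is thus at least as close to 1 as its square, which carries the bound of
  \<open>branch_box\<close> over from the cubic to its root.\<close>

lemma norm_branch_diff_le:
  assumes "w \<noteq> 0"
  shows "norm (branch w v / w - 1) \<le> norm (v / w ^ 2 - 1)"
proof -
  let ?c = "csqrt (v / w ^ 2)"
  have "1 \<le> Re (?c + 1)"
    using csqrt_principal[of "v / w ^ 2"] by auto
  then have "1 \<le> norm (?c + 1)"
    using complex_Re_le_cmod order_trans by blast
  then have "norm (?c - 1) \<le> norm (?c - 1) * norm (?c + 1)"
    by (simp add: mult_le_cancel_left1)
  also have "\<dots> = norm (?c ^ 2 - 1)"
    by (simp add: norm_mult[symmetric] power2_eq_square algebra_simps)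
  finally show ?thesis using assms by (simp add: branch_def)
qed

lemma branch_domain:
  fixes u :: complex
  assumes "norm (u - 1) < 1"
  shows "u \<notin> \<real>\<^sub>\<le>\<^sub>0"
proof
  assume "u \<in> \<real>\<^sub>\<le>\<^sub>0"
  then have "Re u \<le> 0" by (simp add: complex_nonpos_Reals_iff)
  then have "1 \<le> \<bar>Re (u - 1)\<bar>" by simp
  then show False using abs_Re_le_cmod[of "u - 1"] assms by linarith
qed

lemma has_field_derivative_branch:
  assumes "w \<noteq> 0" "norm (v / w ^ 2 - 1) < 1"
  shows "(branch w has_field_derivative 1 / (2 * branch w v)) (at v)"
proof -
  have "v / w ^ 2 \<notin> \<real>\<^sub>\<le>\<^sub>0" using branch_domain assms(2) by blast
  then have "((\<lambda>v. w * csqrt (v / w ^ 2)) has_field_derivative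
       w * (inverse (2 * csqrt (v / w ^ 2)) * (1 / w ^ 2))) (at v)"
    using assms(1) by (auto intro!: derivative_eq_intros simp: eval_nat_numeral inverse_eq_divide)
  moreover have "w * (inverse (2 * csqrt (v / w ^ 2)) * (1 / w ^ 2)) = 1 / (2 * branch w v)"
    using assms(1) by (simp add: branch_def field_simps power2_eq_square)
  ultimately show ?thesis by (simp add: branch_def[abs_def])
qed

text \<open>Here \<open>norm (s - t) < 1/2\<close> and \<open>norm t > 3/4\<close>, so
  \<open>s / t\<close> has distance less than 1 from 1. Together with \<open>branch_eqI\<close> this
  decides that two roots have the same sign.\<close>

lemma Re_divide_pos_near_1:
  fixes s t :: complex
  assumes "norm (s - 1) < 1 / 4" "norm (t - 1) < 1 / 4"
  shows "0 < Re (s / t)"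
proof -
  have t: "t \<noteq> 0" using assms(2) by auto
  have "norm (s - t) < norm t"
  proof -
    have "norm (s - t) \<le> norm (s - 1) + norm (t - 1)"
      by (metis norm_minus_commute norm_triangle_ineq4 diff_diff_eq2 diff_add_cancel add_diff_cancel_right')
    moreover have "1 \<le> norm t + norm (t - 1)"
      by (metis norm_one norm_triangle_sub add.commute norm_minus_commute)
    ultimately show ?thesis using assms by linarith
  qed
  then have "norm (s / t - 1) < 1"
    using t by (metis diff_divide_distrib divide_less_eq_1_pos divide_self norm_divide zero_less_norm_iff)
  then show ?thesis
    using abs_Re_le_cmod[of "s / t - 1"] by (auto simp: abs_less_iff)
qed

lemma branch_nonzero:
  assumes "w \<noteq> 0" "norm (v / w ^ 2 - 1) < 1"
  shows "branch w v \<noteq> 0"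
  using assms branch_square[of w v] by auto

lemma continuous_on_branch:
  assumes "w \<noteq> 0" "continuous_on S f" "\<And>x. x \<in> S \<Longrightarrow> norm (f x / w ^ 2 - 1) < 1"
  shows "continuous_on S (\<lambda>x. branch w (f x))"
proof (rule continuous_on_compose2[OF _ assms(2)])
  show "continuous_on {v. norm (v / w ^ 2 - 1) < 1} (branch w)"
    using has_field_derivative_branch[OF assms(1)] DERIV_isCont
    by (intro continuous_at_imp_continuous_on) blast
qed (use assms(3) in auto)

lemma holomorphic_on_branch:
  assumes "w \<noteq> 0" "f holomorphic_on S" "\<And>x. x \<in> S \<Longrightarrow> norm (f x / w ^ 2 - 1) < 1"
  shows "(\<lambda>x. branch w (f x)) holomorphic_on S"
proof -
  have "branch w holomorphic_on {v. norm (v / w ^ 2 - 1) < 1}"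
    using has_field_derivative_branch[OF assms(1)]
    unfolding holomorphic_on_def field_differentiable_def
    by (blast intro: DERIV_subset)
  from holomorphic_on_compose_gen[OF assms(2) this] assms(3) show ?thesis
    by (auto simp: comp_def)
qed

section \<open>Integrals inside a disc and their dependence on a parameter\<close>

lemma linepath_primitive:
  assumes "convex B" "open B" "H holomorphic_on B"
  obtains G where "\<And>z. z \<in> B \<Longrightarrow> (G has_field_derivative H z) (at z)"
    "\<And>z z'. z \<in> B \<Longrightarrow> z' \<in> B \<Longrightarrow> contour_integral (linepath z z') H = G z' - G z"
proof -
  obtain G where G: "\<And>z. z \<in> B \<Longrightarrow> (G has_field_derivative H z) (at z within B)"
    using holomorphic_convex_primitive'[OF assms] by blast
  show thesis
  proof
    show "(G has_field_derivative H z) (at z)" if "z \<in> B" for z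
      using G[OF that] at_within_open[OF that assms(2)] by simp
    show "contour_integral (linepath z z') H = G z' - G z" if "z \<in> B" "z' \<in> B" for z z'
    proof -
      have "path_image (linepath z z') \<subseteq> B"
        using assms(1) that by (simp add: closed_segment_subset)
      then show ?thesis
        using contour_integral_primitive[OF G valid_path_linepath]
        by (metis contour_integral_unique pathstart_linepath pathfinish_linepath)
    qed
  qed
qed

text \<open>The derivative of \<open>x\<close> may be unbounded near \<open>S\<close>, so
  integrability itself has to come from a primitive of \<open>H\<close>. The derivative is taken
  within {0..1} to match \<open>simplex_integral\<close>; inside {s..u} it is the two-sided
  one.\<close>

lemma local_ftc:
  assumes B: "convex B" "open B" "H holomorphic_on B"
    and x: "continuous_on {s..u} x" "x ` {s..u} \<subseteq> B"
    and S: "finite S" "\<And>t. t \<in> {s..u} - S \<Longrightarrow> x differentiable (at t)"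
    and su: "0 \<le> s" "s \<le> u" "u \<le> 1"
  shows "((\<lambda>t. H (x t) * vector_derivative x (at t within {0..1})) has_integral
     contour_integral (linepath (x s) (x u)) H) {s..u}"
proof -
  obtain G where G: "\<And>z. z \<in> B \<Longrightarrow> (G has_field_derivative H z) (at z)"
    "\<And>z z'. z \<in> B \<Longrightarrow> z' \<in> B \<Longrightarrow> contour_integral (linepath z z') H = G z' - G z"
    using linepath_primitive[OF B] by blast
  have ends: "x s \<in> B" "x u \<in> B" using x(2) su by auto
  have "((\<lambda>t. H (x t) * vector_derivative x (at t within {0..1})) has_integral
     ((G \<circ> x) u - (G \<circ> x) s)) {s..u}"
  proof (rule fundamental_theorem_of_calculus_interior_strong[OF S(1) su(2)])
    fix t assume t: "t \<in> {s<..<u} - S"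
    have "vector_derivative x (at t within {0..1}) = vector_derivative x (at t)"
      using t su by (intro vector_derivative_at_within_ivl[where a=0 and b=1])
        (auto intro: S(2)[THEN vector_derivative_works[THEN iffD1]])
    moreover have "(x has_vector_derivative vector_derivative x (at t)) (at t)"
      using S(2)[of t] t vector_derivative_works by auto
    moreover have "x t \<in> B" using t x(2) by auto
    ultimately show "(G \<circ> x has_vector_derivative H (x t) * vector_derivative x (at t within {0..1})) (at t)"
      using field_vector_diff_chain_at[of x _ t G "H (x t)"] G(1) by (metis mult.commute)
  next
    have "continuous_on B G"
      using G(1) DERIV_isCont continuous_at_imp_continuous_on by blast
    then show "continuous_on {s..u} (G \<circ> x)"
      using x continuous_on_compose continuous_on_subset by blast
  qed
  then show ?thesis using G(2)[OF ends] by simp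
qed

text \<open>A bound below 1 keeps the cubic in the domain of \<open>branch w\<close>; 1/4 is what
  \<open>Re_divide_pos_near_1\<close> asks for when roots are compared. One radius serves both the
  parameter and the abscissa.\<close>

lemma branch_box:
  fixes q g :: "complex \<Rightarrow> complex"
  assumes "q holomorphic_on UNIV" "g holomorphic_on UNIV" "w \<noteq> 0" "w ^ 2 = q z"
  obtains r where "r > 0"
    "\<And>h \<xi> :: complex. h \<in> ball 0 r \<Longrightarrow> \<xi> \<in> ball z r \<Longrightarrow> norm ((q \<xi> + h * g \<xi>) / w ^ 2 - 1) < 1 / 4"
proof -
  have cq: "isCont q u" "isCont g u" for u
    using assms(1,2) holomorphic_on_imp_continuous_on continuous_on_eq_continuous_at by blast+
  have "isCont (\<lambda>p. (q (snd p) + fst p * g (snd p)) / w ^ 2 - 1) (0, z)"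
    using assms(3) by (intro continuous_intros isCont_o2[OF _ cq(1)] isCont_o2[OF _ cq(2)]) auto
  then obtain d where d: "d > 0" "\<And>p. dist p (0, z) < d \<Longrightarrow>
      dist ((q (snd p) + fst p * g (snd p)) / w ^ 2 - 1) 0 < 1 / 4"
    using assms(3,4) unfolding continuous_at_eps_delta
    by (metis (no_types, lifting) add.right_neutral cancel_comm_monoid_add_class.diff_cancel
        divide_self_if fst_conv lambda_zero less_divide_eq_1_pos mult_zero_left power_not_zero snd_conv
        zero_less_divide_1_iff zero_less_numeral)
  show thesis
  proof (rule that[of "d / 2"])
    fix h \<xi> :: complex assume "h \<in> ball 0 (d / 2)" "\<xi> \<in> ball z (d / 2)"
    then have "dist (h, \<xi>) (0, z) < d"
      using dist_Pair_Pair[of h \<xi> 0 z] sqrt_sum_squares_le_sum_abs[of "dist h 0" "dist \<xi> z"]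
      by (simp add: dist_commute)
    then show "norm ((q \<xi> + h * g \<xi>) / w ^ 2 - 1) < 1 / 4"
      using d(2)[of "(h, \<xi>)"] by simp
  qed (use d(1) in simp)
qed

text \<open>On a segment independent of \<open>h\<close>, the integrand and its derivative in
  \<open>h\<close> are jointly continuous, so Leibniz' rule applies.\<close>

lemma contour_integral_branch_deriv:
  assumes qg: "q holomorphic_on UNIV" "g holomorphic_on UNIV" and w: "w \<noteq> 0" and r: "r > 0"
    and box: "\<And>h \<xi>. h \<in> ball 0 r \<Longrightarrow> \<xi> \<in> ball z r \<Longrightarrow> norm ((q \<xi> + h * g \<xi>) / w ^ 2 - 1) < 1 / 4"
    and z: "z1 \<in> ball z r" "z2 \<in> ball z r"
  shows "((\<lambda>h. contour_integral (linepath z1 z2) (\<lambda>\<xi>. branch w (q \<xi> + h * g \<xi>)))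
     has_field_derivative contour_integral (linepath z1 z2) (\<lambda>\<xi>. g \<xi> / (2 * branch w (q \<xi>)))) (at 0)"
proof -
  let ?l = "linepath z1 z2"
  define f where "f h t = branch w (q (?l t) + h * g (?l t)) * (z2 - z1)" for h t
  define f' where "f' h t = g (?l t) / (2 * branch w (q (?l t) + h * g (?l t))) * (z2 - z1)" for h t
  have l: "?l t \<in> ball z r" if "t \<in> {0..1}" for t
    using z that convex_ball[of z r] closed_segment_subset[of z1 "ball z r" z2]
      linepath_image_01[of z1 z2] by blast
  have box1: "norm ((q (?l t) + h * g (?l t)) / w ^ 2 - 1) < 1" if "t \<in> {0..1}" "h \<in> ball 0 r" for t h
    using box[OF that(2) l[OF that(1)]] by simp
  have nz: "branch w (q (?l t) + h * g (?l t)) \<noteq> 0" if "t \<in> {0..1}" "h \<in> ball 0 r" for t h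
    using branch_nonzero[OF w box1[OF that]] .
  have cqg: "continuous_on UNIV q" "continuous_on UNIV g"
    using qg holomorphic_on_imp_continuous_on by blast+
  have cont: "continuous_on (ball 0 r \<times> {0..1}) (\<lambda>(h, t). branch w (q (?l t) + h * g (?l t)))"
    unfolding split_beta using box1
    by (intro continuous_on_branch[OF w] continuous_intros
        continuous_on_compose2[OF cqg(1)] continuous_on_compose2[OF cqg(2)]
        continuous_on_compose2[OF continuous_on_linepath[of UNIV]]) auto
  have "((\<lambda>h. integral (cbox 0 1) (f h)) has_field_derivative integral (cbox 0 1) (f' 0))
      (at 0 within ball 0 r)"
  proof (rule leibniz_rule_field_derivative)
    fix h :: complex and t assume ht: "h \<in> ball 0 r" "t \<in> cbox (0::real) 1"
    then have "(branch w has_field_derivative 1 / (2 * branch w (q (?l t) + h * g (?l t))))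
        (at (q (?l t) + h * g (?l t)))"
      using has_field_derivative_branch[OF w box1] by simp
    moreover have "((\<lambda>h. q (?l t) + h * g (?l t)) has_field_derivative g (?l t)) (at h)"
      by (auto intro!: derivative_eq_intros)
    ultimately have "((\<lambda>h. f h t) has_field_derivative f' h t) (at h)"
      unfolding f_def f'_def by (auto intro!: derivative_eq_intros DERIV_chain2)
    then show "((\<lambda>h. f h t) has_field_derivative f' h t) (at h within ball 0 r)"
      by (rule DERIV_subset) simp
  next
    fix h assume h: "h \<in> ball (0::complex) r"
    have "continuous_on {0..1} (f h)"
      unfolding f_def using box1 h
      by (intro continuous_on_branch[OF w] continuous_intros
        continuous_on_compose2[OF cqg(1)] continuous_on_compose2[OF cqg(2)]
        continuous_on_compose2[OF continuous_on_linepath[of UNIV]]) auto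
    then show "f h integrable_on cbox 0 1"
      by (simp add: integrable_continuous_real)
  next
    show "continuous_on (ball 0 r \<times> cbox 0 1) (\<lambda>(h, t). f' h t)"
      unfolding f'_def split_beta using nz cont[unfolded split_beta]
      by (auto intro!: continuous_intros continuous_on_compose2[OF cqg(2)]
        continuous_on_compose2[OF continuous_on_linepath[of UNIV]])
  qed (use r in auto)
  then have "((\<lambda>h. integral (cbox 0 1) (f h)) has_field_derivative integral (cbox 0 1) (f' 0)) (at 0)"
    using r by (simp add: at_within_open[of _ "ball 0 r"])
  then show ?thesis
    unfolding f_def[abs_def] f'_def[abs_def] by (simp add: contour_integral_integral)
qed

text \<open>The correction at an end point: \<open>P\<close> lies on the original curve,
  \<open>z'\<close> is the displaced abscissa, and the root is continued from the sign of
  \<open>snd P\<close>. It refers to the points only and not to the edge, which is what lets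
  corrections of different edges cancel.\<close>

definition segment_integral ::
  "(complex \<Rightarrow> complex) \<Rightarrow> (complex \<Rightarrow> complex) \<Rightarrow> complex \<Rightarrow> complex \<times> complex \<Rightarrow> complex \<Rightarrow> complex" where
  "segment_integral q g h P z' =
     contour_integral (linepath (fst P) z') (\<lambda>\<xi>. branch (snd P) (q \<xi> + h * g \<xi>))"

text \<open>\<open>q\<close> is the cubic at the centre and \<open>g\<close> its derivative in a
  fixed direction. As the cubic is affine in \<open>(a, b)\<close>, \<open>q + h * g\<close> is
  exactly the displaced cubic. The break points may depend on \<open>h\<close> in any way, in
  keeping with \<open>locally_constant_at\<close>.\<close>

locale curve_deformation =
  fixes q g :: "complex \<Rightarrow> complex" and x y :: "complex \<Rightarrow> real \<Rightarrow> complex" and \<rho> :: real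
  assumes hol: "q holomorphic_on UNIV" "g holomorphic_on UNIV"
    and rho: "\<rho> > 0"
    and cont: "continuous_on (ball 0 \<rho> \<times> {0..1}) (\<lambda>(h, t). x h t)"
      "continuous_on (ball 0 \<rho> \<times> {0..1}) (\<lambda>(h, t). y h t)"
    and on_curve: "\<And>h t. h \<in> ball 0 \<rho> \<Longrightarrow> t \<in> {0..1} \<Longrightarrow> y h t ^ 2 = q (x h t) + h * g (x h t)"
    and nonzero: "\<And>h t. h \<in> ball 0 \<rho> \<Longrightarrow> t \<in> {0..1} \<Longrightarrow> y h t \<noteq> 0"
    and piecewise: "\<And>h. h \<in> ball 0 \<rho> \<Longrightarrow> \<exists>S. finite S \<and> (\<forall>t\<in>{0..1} - S. x h differentiable (at t))"
begin

abbreviation K :: "complex \<Rightarrow> real \<Rightarrow> complex" where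
  "K h t \<equiv> segment_integral q g h (x 0 t, y 0 t) (x h t)"

text \<open>No derivative of \<open>K\<close> is claimed, since the end points move only
  continuously; all differentiability is put into \<open>J\<close>, whose derivative is tied to the
  integral of the differentiated form. The statement is additive under subdivision of the interval,
  so it can be proved locally.\<close>

definition deformable :: "real \<Rightarrow> real \<Rightarrow> bool" where
  "deformable s u \<longleftrightarrow> (\<exists>J D e. 0 < e \<and> e \<le> \<rho> \<and>
     (\<forall>h\<in>ball 0 e. ((\<lambda>t. y h t * vector_derivative (x h) (at t within {0..1})) has_integral
        J h + K h u - K h s) {s..u}) \<and>
     (J has_field_derivative D) (at 0) \<and>
     ((\<lambda>t. g (x 0 t) / (2 * y 0 t) * vector_derivative (x 0) (at t within {0..1})) has_integral D) {s..u})"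

lemma deformable_trans:
  assumes "deformable s u" "deformable u v" "s \<le> u" "u \<le> v"
  shows "deformable s v"
proof -
  obtain J D e where 1: "0 < e" "e \<le> \<rho>"
     "\<And>h. h\<in>ball 0 e \<Longrightarrow> ((\<lambda>t. y h t * vector_derivative (x h) (at t within {0..1})) has_integral
        J h + K h u - K h s) {s..u}"
     "(J has_field_derivative D) (at 0)"
     "((\<lambda>t. g (x 0 t) / (2 * y 0 t) * vector_derivative (x 0) (at t within {0..1})) has_integral D) {s..u}"
    using assms(1) unfolding deformable_def by blast
  obtain J' D' e' where 2: "0 < e'" "e' \<le> \<rho>"
     "\<And>h. h\<in>ball 0 e' \<Longrightarrow> ((\<lambda>t. y h t * vector_derivative (x h) (at t within {0..1})) has_integral
        J' h + K h v - K h u) {u..v}"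
     "(J' has_field_derivative D') (at 0)"
     "((\<lambda>t. g (x 0 t) / (2 * y 0 t) * vector_derivative (x 0) (at t within {0..1})) has_integral D') {u..v}"
    using assms(2) unfolding deformable_def by blast
  have "((\<lambda>t. y h t * vector_derivative (x h) (at t within {0..1})) has_integral
        (J h + J' h) + K h v - K h s) {s..v}" if "h \<in> ball 0 (min e e')" for h
    using has_integral_combine[OF assms(3,4) 1(3)[of h] 2(3)[of h]] that by (simp add: algebra_simps)
  moreover have "((\<lambda>h. J h + J' h) has_field_derivative D + D') (at 0)"
    using 1(4) 2(4) by (rule DERIV_add)
  moreover note has_integral_combine[OF assms(3,4) 1(5) 2(5)]
  ultimately show ?thesis
    unfolding deformable_def using 1(1,2) 2(1)
    by (intro exI[of _ "\<lambda>h. J h + J' h"] exI[of _ "D + D'"] exI[of _ "min e e'"]) auto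
qed

text \<open>Near \<open>t0\<close> and for small \<open>h\<close> everything happens over one disc
  carrying a single branch of the root of \<open>q + h * g\<close>, so integrals there depend on end
  points only.\<close>

lemma deformable_local:
  assumes t0: "t0 \<in> {0..1}"
  obtains d where "d > 0"
    "\<And>s u. s \<le> t0 \<Longrightarrow> t0 \<le> u \<Longrightarrow> u - s < d \<Longrightarrow> 0 \<le> s \<Longrightarrow> u \<le> 1 \<Longrightarrow> deformable s u"
proof -
  define z w where "z = x 0 t0" and "w = y 0 t0"
  have w: "w \<noteq> 0" "w ^ 2 = q z"
    using nonzero[of 0 t0] on_curve[of 0 t0] t0 rho by (auto simp: z_def w_def)
  obtain r where r: "r > 0" and box: "\<And>h \<xi>. h \<in> ball 0 r \<Longrightarrow> \<xi> \<in> ball z r \<Longrightarrow>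
      norm ((q \<xi> + h * g \<xi>) / w ^ 2 - 1) < 1 / 4"
    using branch_box[OF hol w] by blast
  have p0: "(0, t0) \<in> ball 0 \<rho> \<times> {0..1::real}" using t0 rho by auto
  obtain d1 where d1: "d1 > 0" "\<And>p. p \<in> ball 0 \<rho> \<times> {0..1} \<Longrightarrow> dist p (0, t0) < d1 \<Longrightarrow>
      dist (case p of (h, t) \<Rightarrow> x h t) (case (0, t0) of (h, t) \<Rightarrow> x h t) < r"
    using cont(1)[unfolded continuous_on_iff, rule_format, OF p0 r] by blast
  have w4: "norm w / 4 > 0" using w by simp
  obtain d2 where d2: "d2 > 0" "\<And>p. p \<in> ball 0 \<rho> \<times> {0..1} \<Longrightarrow> dist p (0, t0) < d2 \<Longrightarrow>
      dist (case p of (h, t) \<Rightarrow> y h t) (case (0, t0) of (h, t) \<Rightarrow> y h t) < norm w / 4"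
    using cont(2)[unfolded continuous_on_iff, rule_format, OF p0 w4] by blast
  \<comment> \<open>Halves of \<open>d1\<close> and \<open>d2\<close>, because the distance of
    \<open>(h, t)\<close> from \<open>(0, t0)\<close> is bounded by a sum of two terms, each below
    \<open>d\<close>.\<close>
  define d where "d = min (min (d1 / 2) (d2 / 2)) (min r \<rho>)"
  have d: "d > 0" "d \<le> r" "d \<le> \<rho>" using d1(1) d2(1) r rho by (auto simp: d_def)
  have near: "x h t \<in> ball z r" "norm (y h t / w - 1) < 1 / 4"
    if "h \<in> ball 0 d" "t \<in> {0..1}" "\<bar>t - t0\<bar> < d" for h t
  proof -
    have "dist (h, t) (0, t0) \<le> norm h + \<bar>t - t0\<bar>"
      using sqrt_sum_squares_le_sum_abs[of "dist h 0" "dist t t0"] by (simp add: dist_Pair_Pair dist_norm[of h] dist_real_def)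
    then have "dist (h, t) (0, t0) < d1" "dist (h, t) (0, t0) < d2"
      using that by (auto simp: d_def)
    then show "x h t \<in> ball z r"
      using d1(2)[of "(h, t)"] that d(3) by (auto simp: dist_commute z_def)
    have "dist (y h t) w < norm w / 4"
      using \<open>dist (h, t) (0, t0) < d2\<close> d2(2)[of "(h, t)"] that d(3) by (auto simp: w_def)
    then have "norm (y h t - w) / norm w < 1 / 4"
      using w(1) by (simp add: dist_norm divide_simps)
    then show "norm (y h t / w - 1) < 1 / 4"
      using w(1) by (metis diff_divide_distrib divide_self norm_divide)
  qed
  let ?F = "\<lambda>h \<xi>. branch w (q \<xi> + h * g \<xi>)"
  have box1: "norm ((q \<xi> + h * g \<xi>) / w ^ 2 - 1) < 1" if "h \<in> ball 0 d" "\<xi> \<in> ball z r" for h \<xi>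
  proof -
    have "h \<in> ball 0 r" using that(1) d(2) by auto
    from box[OF this that(2)] show ?thesis by linarith
  qed
  have Fhol: "?F h holomorphic_on ball z r" if "h \<in> ball 0 d" for h
    using box1[OF that] hol
    by (intro holomorphic_on_branch[OF w(1)] holomorphic_intros) (auto intro: holomorphic_on_subset)
  have yF: "y h t = ?F h (x h t)" if "h \<in> ball 0 d" "t \<in> {0..1}" "\<bar>t - t0\<bar> < d" for h t
    using branch_eqI[of w "y h t"] near[OF that] on_curve[of h t] that d(3) w(1)
      Re_divide_pos_near_1[of "y h t / w" 1] by auto
  \<comment> \<open>\<open>K\<close> uses the root based at \<open>y 0 t\<close>, \<open>?F\<close>
    the one based at \<open>w\<close>. Both \<open>branch w ?v / w\<close> and
    \<open>y 0 t / w\<close> lie within 1/4 of 1, so the signs agree.\<close>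
  have KF: "K h t = contour_integral (linepath (x 0 t) (x h t)) (?F h)"
    if "h \<in> ball 0 d" "t \<in> {0..1}" "\<bar>t - t0\<bar> < d" for h t
    unfolding segment_integral_def fst_conv snd_conv
  proof (rule contour_integral_eq)
    fix \<xi> assume "\<xi> \<in> path_image (linepath (x 0 t) (x h t))"
    moreover have "closed_segment (x 0 t) (x h t) \<subseteq> ball z r"
      using near(1)[of 0 t] near(1)[of h t] that d(1) by (intro closed_segment_subset) auto
    ultimately have xi: "\<xi> \<in> ball z r" by auto
    let ?v = "q \<xi> + h * g \<xi>"
    have "norm (branch w ?v / w - 1) < 1 / 4"
      using norm_branch_diff_le[OF w(1), of ?v] box[of h \<xi>] xi that d(2) by fastforce
    then have "0 < Re ((branch w ?v / w) / (y 0 t / w))"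
      using near(2)[of 0 t] that d(1) by (intro Re_divide_pos_near_1) auto
    then show "branch (y 0 t) ?v = branch w ?v"
      using w(1) that rho nonzero[of 0 t] by (intro branch_eqI branch_square) auto
  qed
  show thesis
  proof (rule that[OF d(1)])
    fix s u assume su: "s \<le> t0" "t0 \<le> u" "u - s < d" "0 \<le> s" "u \<le> 1"
    then have int: "t \<in> {0..1}" "\<bar>t - t0\<bar> < d" if "t \<in> {s..u}" for t
      using that by auto
    define J where "J h = contour_integral (linepath (x 0 s) (x 0 u)) (?F h)" for h
    define D where "D = contour_integral (linepath (x 0 s) (x 0 u)) (\<lambda>\<xi>. g \<xi> / (2 * branch w (q \<xi>)))"
    have ftc: "((\<lambda>t. H (x h t) * vector_derivative (x h) (at t within {0..1})) has_integral
        contour_integral (linepath (x h s) (x h u)) H) {s..u}"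
      if h: "h \<in> ball 0 d" and H: "H holomorphic_on ball z r" for h H
    proof -
      obtain S where S: "finite S" "\<And>t. t \<in> {0..1} - S \<Longrightarrow> x h differentiable (at t)"
        using piecewise[of h] h d(3) by auto
      have "continuous_on {s..u} (\<lambda>t. case (h, t) of (h, t) \<Rightarrow> x h t)"
        using h su d(3) by (intro continuous_on_compose2[OF cont(1)]) (auto intro!: continuous_intros)
      then show ?thesis
        using near(1)[OF h int] su by (intro local_ftc[OF _ _ H _ _ S(1)] S(2)) auto
    qed
    have "((\<lambda>t. y h t * vector_derivative (x h) (at t within {0..1})) has_integral
        J h + K h u - K h s) {s..u}" if h: "h \<in> ball 0 d" for h
    proof -
      obtain G where G: "\<And>\<xi> \<xi>'. \<xi> \<in> ball z r \<Longrightarrow> \<xi>' \<in> ball z r \<Longrightarrow>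
          contour_integral (linepath \<xi> \<xi>') (?F h) = G \<xi>' - G \<xi>"
        using linepath_primitive[OF convex_ball open_ball Fhol[OF h]] by metis
      have "0 \<in> ball (0::complex) d" "s \<in> {s..u}" "u \<in> {s..u}" using d(1) su by auto
      note pts = near(1)[OF this(1) int[OF this(2)]] near(1)[OF this(1) int[OF this(3)]]
        near(1)[OF h int[OF this(2)]] near(1)[OF h int[OF this(3)]]
      \<comment> \<open>A detour with the same ends: from \<open>x h s\<close> back to
        \<open>x 0 s\<close> (minus \<open>K h s\<close>), along the fixed segment to
        \<open>x 0 u\<close> (\<open>J h\<close>), and out to \<open>x h u\<close>
        (\<open>K h u\<close>).\<close>
      have "contour_integral (linepath (x h s) (x h u)) (?F h) = J h + K h u - K h s"
        using KF[OF h int] su by (simp add: J_def G[OF pts(1) pts(2)] G[OF pts(1) pts(3)] G[OF pts(2) pts(4)] G[OF pts(3) pts(4)])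
      moreover have "((\<lambda>t. y h t * vector_derivative (x h) (at t within {0..1})) has_integral
          contour_integral (linepath (x h s) (x h u)) (?F h)) {s..u}"
        by (rule has_integral_eq[OF _ ftc[OF h Fhol[OF h]]]) (use yF[OF h int] in simp)
      ultimately show ?thesis by simp
    qed
    moreover have "(J has_field_derivative D) (at 0)"
      unfolding J_def[abs_def] D_def
      using near(1)[of 0] int d(1) su
      by (intro contour_integral_branch_deriv[OF hol w(1) r box]) auto
    moreover have "((\<lambda>t. g (x 0 t) / (2 * y 0 t) * vector_derivative (x 0) (at t within {0..1}))
        has_integral D) {s..u}"
      unfolding D_def
    proof (rule has_integral_eq[OF _ ftc])
      have F0: "branch w (q \<xi>) \<noteq> 0" if "\<xi> \<in> ball z r" for \<xi>
        using branch_nonzero[OF w(1), of "q \<xi>"] box1[of 0 \<xi>] that d(1) by simp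
      show "(\<lambda>\<xi>. g \<xi> / (2 * branch w (q \<xi>))) holomorphic_on ball z r"
        using Fhol[of 0] F0 d(1) hol
        by (intro holomorphic_intros) (auto intro: holomorphic_on_subset)
      show "g (x 0 t) / (2 * branch w (q (x 0 t))) * vector_derivative (x 0) (at t within {0..1}) =
         g (x 0 t) / (2 * y 0 t) * vector_derivative (x 0) (at t within {0..1})" if "t \<in> {s..u}" for t
        using yF[of 0 t] int[OF that] d(1) by simp
    qed (use d(1) in simp)
    ultimately show "deformable s u"
      unfolding deformable_def using d by blast
  qed
qed

lemma deformable_unit: "deformable 0 1"
proof -
  \<comment> \<open>The local condition of \<open>Bolzano\<close> also ranges over intervals
    sticking out of {0..1}; the guard makes \<open>P\<close> vacuous for them.\<close>
  define P where "P s u \<longleftrightarrow> (0 \<le> s \<and> u \<le> 1 \<longrightarrow> deformable s u)" for s u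
  have "P 0 1"
  proof (rule Bolzano[of 0 1 P])
    show "P a c" if "P a b" "P b c" "a \<le> b" "b \<le> c" for a b c
      using that deformable_trans[of a b c] by (auto simp: P_def)
    show "\<exists>d>0. \<forall>s u. s \<le> t \<and> t \<le> u \<and> u - s < d \<longrightarrow> P s u" if "0 \<le> t" "t \<le> 1" for t
      using deformable_local[of t] that unfolding P_def by (metis atLeastAtMost_iff)
  qed simp
  then show ?thesis by (simp add: P_def)
qed

end

section \<open>Chains\<close>

text \<open>The additive functional on chains with prescribed values on generators. It is separated
  from \<open>chain_integral\<close> because it is also applied to 0-chains and to quantities such
  as \<open>J \<sigma> h\<close> that are not integrals of a form.\<close>

definition linear_extension :: "('b \<Rightarrow> complex) \<Rightarrow> ('b \<Rightarrow>\<^sub>0 int) \<Rightarrow> complex" where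
  "linear_extension \<phi> c = (\<Sum>\<sigma>\<in>Poly_Mapping.keys c. of_int (Poly_Mapping.lookup c \<sigma>) * \<phi> \<sigma>)"

lemma chain_integral_linear_extension:
  "chain_integral f = linear_extension (simplex_integral f)"
  by (simp add: fun_eq_iff chain_integral_def linear_extension_def)

text \<open>Cancellation can remove keys from a sum, so additivity is checked over a common finite
  support.\<close>

lemma linear_extension_superset:
  assumes "finite S" "Poly_Mapping.keys c \<subseteq> S"
  shows "linear_extension \<phi> c = (\<Sum>\<sigma>\<in>S. of_int (Poly_Mapping.lookup c \<sigma>) * \<phi> \<sigma>)"
  unfolding linear_extension_def
  by (rule sum.mono_neutral_left) (use assms in \<open>auto simp: in_keys_iff\<close>)

lemma linear_extension_0 [simp]: "linear_extension \<phi> 0 = 0"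
  by (simp add: linear_extension_def)

lemma linear_extension_of [simp]: "linear_extension \<phi> (frag_of \<sigma>) = \<phi> \<sigma>"
  by (simp add: linear_extension_def)

lemma linear_extension_add: "linear_extension \<phi> (c + d) = linear_extension \<phi> c + linear_extension \<phi> d"
proof -
  let ?S = "Poly_Mapping.keys c \<union> Poly_Mapping.keys d"
  have "Poly_Mapping.keys (c + d) \<subseteq> ?S" by (rule Poly_Mapping.keys_add)
  then show ?thesis
    by (simp add: linear_extension_superset[of ?S] lookup_add sum.distrib ring_distribs)
qed

lemma linear_extension_diff: "linear_extension \<phi> (c - d) = linear_extension \<phi> c - linear_extension \<phi> d"
  using linear_extension_add[of \<phi> "c - d" d] by simp

lemma linear_extension_cmul: "linear_extension \<phi> (frag_cmul k c) = of_int k * linear_extension \<phi> c"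
  by (subst linear_extension_superset[of "Poly_Mapping.keys c"])
    (auto simp: keys_cmul linear_extension_def sum_distrib_left mult.assoc)

lemma linear_extension_sum: "linear_extension \<phi> (\<Sum>i\<in>I. f i) = (\<Sum>i\<in>I. linear_extension \<phi> (f i))"
  by (induction I rule: infinite_finite_induct) (auto simp: linear_extension_add)

lemma linear_extension_frag_extend:
  "linear_extension \<phi> (frag_extend f c) = linear_extension (\<lambda>\<sigma>. linear_extension \<phi> (f \<sigma>)) c"
  unfolding frag_extend_def linear_extension_sum linear_extension_cmul
  by (simp add: linear_extension_def)

text \<open>A 0-simplex is read off at the only point of the standard 0-simplex. Face 0 omits vertex
  0 and therefore yields the end point, at parameter 1.\<close>

lemma singular_face_1_basepoint:
  "singular_face 1 0 \<sigma> (\<lambda>i. if i = 0 then 1 else 0) = edge \<sigma> 1"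
  "singular_face 1 1 \<sigma> (\<lambda>i. if i = 0 then 1 else 0) = edge \<sigma> 0"
proof -
  let ?e = "\<lambda>i::nat. if i = 0 then 1 else 0 :: real"
  have "?e \<in> standard_simplex 0" by (simp add: standard_simplex_def)
  moreover have "simplical_face 0 ?e = (\<lambda>i. if i = 0 then 1 - 1 else if i = 1 then 1 else 0)"
    "simplical_face 1 ?e = (\<lambda>i. if i = 0 then 1 - 0 else if i = 1 then 0 else 0)"
    by (auto simp: simplical_face_def)
  ultimately show "singular_face 1 0 \<sigma> ?e = edge \<sigma> 1" "singular_face 1 1 \<sigma> ?e = edge \<sigma> 0"
    by (simp_all add: singular_face_def edge_def)
qed

text \<open>Both sides evaluate the 0-cochain \<open>H\<close> on the boundary of \<open>c\<close>.
  \<open>H\<close> is an arbitrary function of points, with no continuity; the later use with a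
  noncanonical choice of \<open>H\<close> relies on this.\<close>

lemma linear_extension_boundary:
  assumes "chain_boundary 1 c = 0"
  shows "linear_extension (\<lambda>\<sigma>. H (edge \<sigma> 1) - H (edge \<sigma> 0)) c = 0"
proof -
  let ?ev = "\<lambda>\<tau>. H (\<tau> (\<lambda>i. if i = 0 then 1 else 0))"
  have "linear_extension ?ev (chain_boundary 1 c) =
      linear_extension (\<lambda>\<sigma>. H (edge \<sigma> 1) - H (edge \<sigma> 0)) c"
    by (simp add: chain_boundary_def linear_extension_frag_extend linear_extension_diff
        singular_face_1_basepoint[unfolded One_nat_def] linear_extension_cmul)
  then show ?thesis using assms by simp
qed

lemma linear_extension_cong:
  assumes "\<And>\<sigma>. \<sigma> \<in> Poly_Mapping.keys c \<Longrightarrow> \<phi> \<sigma> = \<psi> \<sigma>"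
  shows "linear_extension \<phi> c = linear_extension \<psi> c"
  using assms by (simp add: linear_extension_def)

lemma linear_extension_linear:
  "linear_extension (\<lambda>\<sigma>. \<phi> \<sigma> + \<psi> \<sigma>) c = linear_extension \<phi> c + linear_extension \<psi> c"
  "linear_extension (\<lambda>\<sigma>. \<phi> \<sigma> - \<psi> \<sigma>) c = linear_extension \<phi> c - linear_extension \<psi> c"
  "linear_extension (\<lambda>\<sigma>. z * \<phi> \<sigma>) c = z * linear_extension \<phi> c"
  by (simp_all add: linear_extension_def sum.distrib sum_subtractf ring_distribs sum_distrib_left mult.left_commute)

lemma smooth_cycle_boundary: "smooth_cycle a b c \<Longrightarrow> chain_boundary 1 c = 0"
  by (simp add: smooth_cycle_def singular_cycle)

section \<open>Forms on the curve and the derivatives of the periods\<close>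

lemma edge_in_curve:
  assumes "smooth_simplex a b \<sigma>" "t \<in> {0..1}"
  shows "snd (edge \<sigma> t) ^ 2 = cubic a b (fst (edge \<sigma> t))"
proof -
  have "(\<lambda>i. if i = 0 then 1 - t else if i = 1 then t else 0) \<in> standard_simplex 1"
    using assms(2) by (auto simp: standard_simplex_def)
  moreover have "\<sigma> \<in> standard_simplex 1 \<rightarrow> curve a b"
    using assms(1) by (auto simp: smooth_simplex_def singular_simplex_def continuous_map_in_subtopology)
  ultimately have "edge \<sigma> t \<in> curve a b" unfolding edge_def by blast
  then show ?thesis by (auto simp: curve_def)
qed

lemma edge_nonzero: "smooth_simplex a b \<sigma> \<Longrightarrow> t \<in> {0..1} \<Longrightarrow> snd (edge \<sigma> t) \<noteq> 0"
  by (auto simp: smooth_simplex_def)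

lemma continuous_on_edge: "smooth_simplex a b \<sigma> \<Longrightarrow> continuous_on {0..1} (edge \<sigma>)"
  by (auto simp: smooth_simplex_def valid_path_def piecewise_C1_differentiable_on_def)

lemma edge_piecewise_differentiable:
  assumes "smooth_simplex a b \<sigma>"
  obtains S where "finite S" "\<And>t. t \<in> {0..1} - S \<Longrightarrow> (\<lambda>t. fst (edge \<sigma> t)) differentiable (at t)"
    "\<And>t. t \<in> {0..1} - S \<Longrightarrow> (\<lambda>t. snd (edge \<sigma> t)) differentiable (at t)"
proof -
  obtain S where S: "finite S" "edge \<sigma> C1_differentiable_on ({0..1} - S)"
    using assms by (auto simp: smooth_simplex_def valid_path_def piecewise_C1_differentiable_on_def)
  show thesis
  proof (rule that[OF S(1)])
    fix t assume "t \<in> {0..1} - S"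
    then have "edge \<sigma> differentiable (at t)"
      using S(2) unfolding C1_differentiable_on_eq by blast
    then obtain f' where f': "(edge \<sigma> has_derivative f') (at t)"
      unfolding differentiable_def by blast
    show "(\<lambda>t. fst (edge \<sigma> t)) differentiable (at t)"
      using has_derivative_fst[OF f'] unfolding differentiable_def by blast
    show "(\<lambda>t. snd (edge \<sigma> t)) differentiable (at t)"
      using has_derivative_snd[OF f'] unfolding differentiable_def by blast
  qed
qed

lemma holomorphic_on_cubic: "cubic a b holomorphic_on S"
  unfolding cubic_def[abs_def] by (intro holomorphic_intros)

lemma wkb_0:
  assumes "y ^ 2 = cubic a b x" "y \<noteq> 0"
  shows "wkb a b 0 (x, y) = y"
  using assms(2) by (simp add: wkb_def assms(1)[symmetric])

text \<open>A valid path may have an unbounded derivative near its break points, so integrability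
  is obtained from local primitives and not from continuity.\<close>

lemma integrable_over_edge:
  assumes \<sigma>: "smooth_simplex a b \<sigma>" and F: "F holomorphic_on UNIV"
  shows "(\<lambda>t. F (fst (edge \<sigma> t)) / snd (edge \<sigma> t) *
    vector_derivative (fst \<circ> edge \<sigma>) (at t within {0..1})) integrable_on {0..1}"
proof -
  let ?x = "\<lambda>t. fst (edge \<sigma> t)" and ?y = "\<lambda>t. snd (edge \<sigma> t)"
  let ?f = "\<lambda>t. F (?x t) / ?y t * vector_derivative ?x (at t within {0..1})"
  obtain S where S: "finite S" "\<And>t. t \<in> {0..1} - S \<Longrightarrow> ?x differentiable (at t)"
      "\<And>t. t \<in> {0..1} - S \<Longrightarrow> ?y differentiable (at t)"
    using edge_piecewise_differentiable[OF \<sigma>] by blast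
  have cont: "continuous_on {0..1} ?x" "continuous_on {0..1} ?y"
    using continuous_on_edge[OF \<sigma>] by (simp_all add: continuous_on_fst continuous_on_snd)
  define P where "P s u \<longleftrightarrow> (0 \<le> s \<and> u \<le> 1 \<longrightarrow> ?f integrable_on {s..u})" for s u
  have "P 0 1"
  proof (rule Bolzano[of 0 1 P])
    show "P r u" if "P r s" "P s u" "r \<le> s" "s \<le> u" for r s u
      using that Henstock_Kurzweil_Integration.integrable_combine[OF that(3,4), of ?f] by (auto simp: P_def)
    show "\<exists>d>0. \<forall>s u. s \<le> t0 \<and> t0 \<le> u \<and> u - s < d \<longrightarrow> P s u" if "0 \<le> t0" "t0 \<le> 1" for t0
    proof -
      define z w where "z = ?x t0" and "w = ?y t0"
      have t0: "t0 \<in> {0..1}" using that by simp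
      have w: "w \<noteq> 0" "w ^ 2 = cubic a b z"
        using edge_in_curve[OF \<sigma> t0] edge_nonzero[OF \<sigma> t0] by (auto simp: z_def w_def)
      obtain r where r: "r > 0" and box: "\<And>h \<xi>. h \<in> ball 0 r \<Longrightarrow> \<xi> \<in> ball z r \<Longrightarrow>
          norm ((cubic a b \<xi> + h * 0) / w ^ 2 - 1) < 1 / 4"
        using branch_box[OF holomorphic_on_cubic holomorphic_on_const w] by blast
      have box1: "norm (cubic a b \<xi> / w ^ 2 - 1) < 1" if "\<xi> \<in> ball z r" for \<xi>
        using box[of 0 \<xi>] that r by simp
      have w0: "norm w > 0" using w by simp
      obtain d1 where d1: "d1 > 0" "\<And>t. t \<in> {0..1} \<Longrightarrow> dist t t0 < d1 \<Longrightarrow> dist (?x t) (?x t0) < r"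
        using cont(1)[unfolded continuous_on_iff, rule_format, OF t0 r] by blast
      obtain d2 where d2: "d2 > 0" "\<And>t. t \<in> {0..1} \<Longrightarrow> dist t t0 < d2 \<Longrightarrow> dist (?y t) (?y t0) < norm w"
        using cont(2)[unfolded continuous_on_iff, rule_format, OF t0 w0] by blast
      have "P s u" if su: "s \<le> t0" "t0 \<le> u" "u - s < min d1 d2" for s u
        unfolding P_def
      proof (rule impI)
        assume su': "0 \<le> s \<and> u \<le> 1"
        have near: "?x t \<in> ball z r" "dist (?y t) w < norm w" if "t \<in> {s..u}" for t
          using d1(2)[of t] d2(2)[of t] that su su' by (auto simp: z_def w_def dist_real_def dist_commute)
        have nz: "branch w (cubic a b \<xi>) \<noteq> 0" if "\<xi> \<in> ball z r" for \<xi>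
          using branch_nonzero[OF w(1) box1[OF that]] .
        have "(\<lambda>\<xi>. F \<xi> / branch w (cubic a b \<xi>)) holomorphic_on ball z r"
          using nz box1 F
          by (intro holomorphic_intros holomorphic_on_branch[OF w(1) holomorphic_on_cubic])
            (auto intro: holomorphic_on_subset)
        moreover have "continuous_on {s..u} ?x"
          using cont(1) su' by (auto intro: continuous_on_subset)
        ultimately have 1: "(\<lambda>t. F (?x t) / branch w (cubic a b (?x t)) *
            vector_derivative ?x (at t within {0..1})) integrable_on {s..u}"
          using near(1) su su' S
          by (intro has_integral_integrable[OF local_ftc[of "ball z r" "\<lambda>\<xi>. F \<xi> / branch w (cubic a b \<xi>)" s u ?x S]]) auto
        have 2: "branch w (cubic a b (?x t)) = ?y t" if "t \<in> {s..u}" for t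
        proof (rule branch_eqI[OF w(1)])
          show "?y t ^ 2 = cubic a b (?x t)"
            using that su' by (intro edge_in_curve[OF \<sigma>]) auto
          have "norm (?y t - w) / norm w < 1"
            using near(2)[OF that] w0 by (simp add: dist_norm divide_simps)
          then have "norm (?y t / w - 1) < 1"
            using w(1) by (metis diff_divide_distrib divide_self norm_divide)
          then show "0 < Re (?y t / w)"
            using abs_Re_le_cmod[of "?y t / w - 1"] by (auto simp: abs_less_iff)
        qed
        show "?f integrable_on {s..u}"
          by (rule integrable_eq[OF 1]) (simp add: 2)
      qed
      then show ?thesis using d1(1) d2(1) by (intro exI[of _ "min d1 d2"]) auto
    qed
  qed simp
  then show ?thesis by (simp add: P_def comp_def)
qed

lemma has_field_derivative_inverse_power:
  fixes y :: complex
  assumes "y \<noteq> 0"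
  shows "((\<lambda>y. 1 / y ^ m) has_field_derivative - of_nat m / y ^ (m + 1)) (at y)"
proof (cases m)
  case (Suc n)
  have "((\<lambda>y. y ^ Suc n) has_field_derivative (1 + of_nat n) * (1 * y ^ n)) (at y)"
    by (rule DERIV_power_Suc[OF DERIV_ident])
  from DERIV_divide[OF DERIV_const this, of 1] assms show ?thesis by (simp add: Suc minus_divide_left)
qed auto

text \<open>The integrand is \<open>d (p / y^m)\<close>: the relation
  \<open>2 y dy = (3 x^2 + a) dx\<close> eliminates \<open>dy\<close>, and
  \<open>y^2 = cubic a b x\<close> brings both terms over \<open>y^(m + 2)\<close>.\<close>

lemma exact_form_over_edge:
  fixes p :: "complex poly" and m :: nat
  assumes \<sigma>: "smooth_simplex a b \<sigma>"
  defines "H \<equiv> \<lambda>(x, y). poly p x / y ^ m"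
  shows "((\<lambda>t. (case edge \<sigma> t of (x, y) \<Rightarrow>
      (poly (pderiv p) x * cubic a b x - of_nat m / 2 * poly p x * (3 * x ^ 2 + a)) / y ^ (m + 2)) *
    vector_derivative (fst \<circ> edge \<sigma>) (at t within {0..1})) has_integral
    H (edge \<sigma> 1) - H (edge \<sigma> 0)) {0..1}"
proof -
  let ?x = "\<lambda>t. fst (edge \<sigma> t)" and ?y = "\<lambda>t. snd (edge \<sigma> t)"
  obtain S where S: "finite S" "\<And>t. t \<in> {0..1} - S \<Longrightarrow> ?x differentiable (at t)"
     "\<And>t. t \<in> {0..1} - S \<Longrightarrow> ?y differentiable (at t)"
    using edge_piecewise_differentiable[OF \<sigma>] by blast
  have cont: "continuous_on {0..1} ?x" "continuous_on {0..1} ?y"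
    using continuous_on_edge[OF \<sigma>] by (simp_all add: continuous_on_fst continuous_on_snd)
  have H: "H (edge \<sigma> t) = poly p (?x t) / ?y t ^ m" for t
    by (simp add: H_def split_beta)
  have "((\<lambda>t. (poly (pderiv p) (?x t) * cubic a b (?x t) -
        of_nat m / 2 * poly p (?x t) * (3 * ?x t ^ 2 + a)) / ?y t ^ (m + 2) *
      vector_derivative ?x (at t within {0..1})) has_integral
      poly p (?x 1) / ?y 1 ^ m - poly p (?x 0) / ?y 0 ^ m) {0..1}"
  proof (rule fundamental_theorem_of_calculus_interior_strong[OF S(1)])
    fix t assume t: "t \<in> {0<..<1} - S"
    define x' y' where "x' = vector_derivative ?x (at t)" and "y' = vector_derivative ?y (at t)"
    have x': "(?x has_vector_derivative x') (at t)" and y': "(?y has_vector_derivative y') (at t)"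
      using S(2,3)[of t] t vector_derivative_works by (auto simp: x'_def y'_def)
    have within: "vector_derivative ?x (at t within {0..1}) = x'"
      unfolding x'_def using t x' by (intro vector_derivative_at_within_ivl[where a=0 and b=1])
        (auto simp: x'_def)
    have yt: "?y t ^ 2 = cubic a b (?x t)" "?y t \<noteq> 0"
      using edge_in_curve[OF \<sigma>] edge_nonzero[OF \<sigma>] t by auto
    \<comment> \<open>The derivative of \<open>y^2\<close> along the edge is computed twice, by the
      chain rule and through the equation of the curve; the latter holds on a neighbourhood of
      \<open>t\<close> because \<open>t\<close> is interior.\<close>
    have "((\<lambda>y. y ^ 2) \<circ> ?y has_vector_derivative y' * (2 * ?y t)) (at t)"
      by (rule field_vector_diff_chain_at[OF y']) (auto intro!: derivative_eq_intros)
    moreover have "(cubic a b \<circ> ?x has_vector_derivative x' * (3 * ?x t ^ 2 + a)) (at t)"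
      by (rule field_vector_diff_chain_at[OF x'])
        (auto simp: cubic_def[abs_def] intro!: derivative_eq_intros)
    then have "((\<lambda>y. y ^ 2) \<circ> ?y has_vector_derivative x' * (3 * ?x t ^ 2 + a)) (at t)"
      by (rule has_vector_derivative_transform_within_open[of _ _ _ "{0<..<1}"])
        (use t edge_in_curve[OF \<sigma>] in auto)
    ultimately have "y' * (2 * ?y t) = x' * (3 * ?x t ^ 2 + a)"
      using vector_derivative_unique_at by blast
    then have y'_eq: "y' = x' * (3 * ?x t ^ 2 + a) / (2 * ?y t)"
      using yt(2) by (simp add: field_simps)
    have "(poly p \<circ> ?x has_vector_derivative x' * poly (pderiv p) (?x t)) (at t)"
      by (rule field_vector_diff_chain_at[OF x']) (rule poly_DERIV)
    moreover have "((\<lambda>y. 1 / y ^ m) \<circ> ?y has_vector_derivative y' * (- of_nat m / ?y t ^ (m + 1))) (at t)"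
      by (rule field_vector_diff_chain_at[OF y' has_field_derivative_inverse_power[OF yt(2)]])
    ultimately have "((\<lambda>t. (poly p \<circ> ?x) t * ((\<lambda>y. 1 / y ^ m) \<circ> ?y) t) has_vector_derivative
        (poly p \<circ> ?x) t * (y' * (- of_nat m / ?y t ^ (m + 1))) +
        x' * poly (pderiv p) (?x t) * ((\<lambda>y. 1 / y ^ m) \<circ> ?y) t) (at t)"
      by (rule has_vector_derivative_mult)
    moreover have "(poly p \<circ> ?x) t * (y' * (- of_nat m / ?y t ^ (m + 1))) +
        x' * poly (pderiv p) (?x t) * ((\<lambda>y. 1 / y ^ m) \<circ> ?y) t =
      (poly (pderiv p) (?x t) * cubic a b (?x t) -
        of_nat m / 2 * poly p (?x t) * (3 * ?x t ^ 2 + a)) / ?y t ^ (m + 2) * x'"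
    proof -
      define Z where "Z = ?y t ^ m"
      have "Z \<noteq> 0" using yt(2) by (simp add: Z_def)
      then show ?thesis
        unfolding yt(1)[symmetric] y'_eq comp_def power_add Z_def[symmetric] using yt(2)
        by (simp add: divide_simps) (simp add: algebra_simps power2_eq_square)
    qed
    ultimately show "((\<lambda>t. poly p (?x t) / ?y t ^ m) has_vector_derivative
        (poly (pderiv p) (?x t) * cubic a b (?x t) -
        of_nat m / 2 * poly p (?x t) * (3 * ?x t ^ 2 + a)) / ?y t ^ (m + 2) *
      vector_derivative ?x (at t within {0..1})) (at t)"
      by (simp add: within comp_def)
  next
    show "continuous_on {0..1} (\<lambda>t. poly p (?x t) / ?y t ^ m)"
      using edge_nonzero[OF \<sigma>] by (intro continuous_intros cont) auto
  qed simp
  then show ?thesis by (simp add: H split_beta comp_def)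
qed

section \<open>Derivatives of the period of \<open>y dx\<close> along locally constant
  families\<close>

lemma simplex_integral_scale: "simplex_integral (\<lambda>P. k * f P) \<sigma> = k * simplex_integral f \<sigma>"
  by (simp add: simplex_integral_def mult.assoc)

text \<open>Serves to recover an original end point from the displaced one, as a function of points
  and not of edges.\<close>

lemma ex_factor_through:
  assumes "\<And>e e'. e \<in> E \<Longrightarrow> e' \<in> E \<Longrightarrow> u e = u e' \<Longrightarrow> v e = v e'"
  obtains \<psi> where "\<And>e. e \<in> E \<Longrightarrow> \<psi> (u e) = v e"
proof
  show "(v \<circ> inv_into E u) (u e) = v e" if "e \<in> E" for e
    using assms[OF inv_into_into[of "u e" u E] that] f_inv_into_f[of "u e" u E] that by auto
qed

lemma curve_deformation_edges:
  assumes "\<rho> > 0" and V: "\<And>h. h \<in> ball 0 \<rho> \<Longrightarrow> (a + h * d1, b + h * d2) \<in> V"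
    and smooth: "\<And>a' b'. (a', b') \<in> V \<Longrightarrow> smooth_simplex a' b' (\<tau> (a', b'))"
    and cont: "continuous_on (V \<times> {0..1}) (\<lambda>(p, t). edge (\<tau> p) t)"
  shows "curve_deformation (cubic a b) (\<lambda>\<xi>. d1 * \<xi> + d2)
    (\<lambda>h t. fst (edge (\<tau> (a + h * d1, b + h * d2)) t))
    (\<lambda>h t. snd (edge (\<tau> (a + h * d1, b + h * d2)) t)) \<rho>"
proof
  have *: "continuous_on (ball 0 \<rho> \<times> {0..1}) (\<lambda>(h, t). edge (\<tau> (a + h * d1, b + h * d2)) t)"
  proof -
    have 1: "continuous_on (ball 0 \<rho> \<times> {0..1::real}) (\<lambda>p. ((a + fst p * d1, b + fst p * d2), snd p))"
      by (intro continuous_intros)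
    have 2: "(\<lambda>p. ((a + fst p * d1, b + fst p * d2), snd p)) ` (ball 0 \<rho> \<times> {0..1::real}) \<subseteq> V \<times> {0..1}"
      using V by auto
    from continuous_on_compose2[OF cont 1 2] show ?thesis by (simp add: split_beta)
  qed
  show "continuous_on (ball 0 \<rho> \<times> {0..1}) (\<lambda>(h, t). fst (edge (\<tau> (a + h * d1, b + h * d2)) t))"
    "continuous_on (ball 0 \<rho> \<times> {0..1}) (\<lambda>(h, t). snd (edge (\<tau> (a + h * d1, b + h * d2)) t))"
    using continuous_on_fst[OF *] continuous_on_snd[OF *] by (simp_all add: split_beta)
  fix h t assume h: "h \<in> ball (0::complex) \<rho>"
  note sm = smooth[OF V[OF h]]
  show "\<exists>S. finite S \<and> (\<forall>t\<in>{0..1} - S.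
      (\<lambda>t. fst (edge (\<tau> (a + h * d1, b + h * d2)) t)) differentiable at t)"
    using edge_piecewise_differentiable[OF sm] by metis
  assume t: "t \<in> {0..1::real}"
  show "(snd (edge (\<tau> (a + h * d1, b + h * d2)) t))\<^sup>2 =
      cubic a b (fst (edge (\<tau> (a + h * d1, b + h * d2)) t)) +
      h * (d1 * fst (edge (\<tau> (a + h * d1, b + h * d2)) t) + d2)"
    using edge_in_curve[OF sm t] by (simp add: cubic_def algebra_simps)
  show "snd (edge (\<tau> (a + h * d1, b + h * d2)) t) \<noteq> 0"
    using edge_nonzero[OF sm t] .
qed (auto intro!: holomorphic_on_cubic holomorphic_intros assms(1))

lemma simplex_integral_wkb_0:
  assumes "smooth_simplex a b \<sigma>"
    and "((\<lambda>t. snd (edge \<sigma> t) * vector_derivative (\<lambda>t. fst (edge \<sigma> t)) (at t within {0..1})) has_integral I) {0..1}"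
  shows "simplex_integral (wkb a b 0) \<sigma> = I"
proof -
  have "wkb a b 0 (edge \<sigma> t) = snd (edge \<sigma> t)" if "t \<in> {0..1}" for t
    using wkb_0[OF edge_in_curve[OF assms(1) that] edge_nonzero[OF assms(1) that]] by simp
  then have "((\<lambda>t. wkb a b 0 (edge \<sigma> t) * vector_derivative (\<lambda>t. fst (edge \<sigma> t)) (at t within {0..1}))
      has_integral I) {0..1}"
    by (intro has_integral_eq[OF _ assms(2)]) simp
  then show ?thesis by (simp add: simplex_integral_def comp_def integral_unique)
qed

text \<open>The admissible radius depends on the simplex; an eventual statement lets finitely many
  simplices be combined. The filter \<open>nhds 0\<close> includes \<open>h = 0\<close>, as
  \<open>DERIV_cong_ev\<close> requires.\<close>

lemma simplex_period_deformation:
  assumes "\<rho> > 0" and V: "\<And>h. h \<in> ball 0 \<rho> \<Longrightarrow> (a + h * d1, b + h * d2) \<in> V"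
    and smooth: "\<And>a' b'. (a', b') \<in> V \<Longrightarrow> smooth_simplex a' b' (\<tau> (a', b'))"
    and cont: "continuous_on (V \<times> {0..1}) (\<lambda>(p, t). edge (\<tau> p) t)"
  obtains J where
    "\<forall>\<^sub>F h in nhds 0. simplex_integral (wkb (a + h * d1) (b + h * d2) 0) (\<tau> (a + h * d1, b + h * d2)) =
       J h + (segment_integral (cubic a b) (\<lambda>\<xi>. d1 * \<xi> + d2) h (edge (\<tau> (a, b)) 1)
                (fst (edge (\<tau> (a + h * d1, b + h * d2)) 1)) -
              segment_integral (cubic a b) (\<lambda>\<xi>. d1 * \<xi> + d2) h (edge (\<tau> (a, b)) 0)
                (fst (edge (\<tau> (a + h * d1, b + h * d2)) 0)))"
    "(J has_field_derivative simplex_integral (\<lambda>(x, y). (d1 * x + d2) / (2 * y)) (\<tau> (a, b))) (at 0)"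
proof -
  let ?e = "\<lambda>h. edge (\<tau> (a + h * d1, b + h * d2))"
  interpret curve_deformation "cubic a b" "\<lambda>\<xi>. d1 * \<xi> + d2" "\<lambda>h t. fst (?e h t)" "\<lambda>h t. snd (?e h t)" \<rho>
    by (rule curve_deformation_edges[OF assms])
  obtain J D e where J: "0 < e" "e \<le> \<rho>"
    "\<And>h. h \<in> ball 0 e \<Longrightarrow> ((\<lambda>t. snd (?e h t) *
        vector_derivative (\<lambda>t. fst (?e h t)) (at t within {0..1})) has_integral J h + K h 1 - K h 0) {0..1}"
    "(J has_field_derivative D) (at 0)"
    "((\<lambda>t. (d1 * fst (?e 0 t) + d2) / (2 * snd (?e 0 t)) *
        vector_derivative (\<lambda>t. fst (?e 0 t)) (at t within {0..1})) has_integral D) {0..1}"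
    using deformable_unit unfolding deformable_def by blast
  show thesis
  proof
    have "D = simplex_integral (\<lambda>(x, y). (d1 * x + d2) / (2 * y)) (\<tau> (a, b))"
      using integral_unique[OF J(5)] by (simp add: simplex_integral_def split_beta comp_def)
    then show "(J has_field_derivative simplex_integral (\<lambda>(x, y). (d1 * x + d2) / (2 * y)) (\<tau> (a, b))) (at 0)"
      using J(4) by simp
    have "\<forall>\<^sub>F h in nhds 0. h \<in> ball 0 e"
      using J(1) by (intro eventually_nhds_in_open) auto
    then show "\<forall>\<^sub>F h in nhds 0. simplex_integral (wkb (a + h * d1) (b + h * d2) 0) (\<tau> (a + h * d1, b + h * d2)) =
       J h + (segment_integral (cubic a b) (\<lambda>\<xi>. d1 * \<xi> + d2) h (edge (\<tau> (a, b)) 1) (fst (?e h 1)) -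
              segment_integral (cubic a b) (\<lambda>\<xi>. d1 * \<xi> + d2) h (edge (\<tau> (a, b)) 0) (fst (?e h 0)))"
    proof eventually_elim
      case (elim h)
      then have "smooth_simplex (a + h * d1) (b + h * d2) (\<tau> (a + h * d1, b + h * d2))"
        using J(2) by (intro smooth V) auto
      from simplex_integral_wkb_0[OF this J(3)[OF elim]] show ?case by simp
    qed
  qed
qed

text \<open>A general direction \<open>(d1, d2)\<close> treats both partial derivatives at
  once.\<close>

lemma Z_0_has_field_derivative:
  assumes \<Gamma>: "locally_constant_at a b \<Gamma>"
  shows "((\<lambda>h. Z 0 (a + h * d1) (b + h * d2) (\<Gamma> (a + h * d1) (b + h * d2))) has_field_derivative
    chain_integral (\<lambda>(x, y). (d1 * x + d2) / (2 * y)) (\<Gamma> a b)) (at 0)"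
proof -
  obtain V and c :: "(complex \<times> complex) chain" and T where V: "open V" "(a, b) \<in> V"
    and family: "\<forall>(a', b')\<in>V. \<Gamma> a' b' = frag_extend (\<lambda>\<sigma>. frag_of (T (a', b') \<sigma>)) c \<and>
        smooth_cycle a' b' (\<Gamma> a' b') \<and>
        (\<forall>\<sigma>\<in>Poly_Mapping.keys c. smooth_simplex a' b' (T (a', b') \<sigma>))"
    and cont: "\<forall>\<sigma>\<in>Poly_Mapping.keys c. continuous_on (V \<times> {0..1}) (\<lambda>(p, t). edge (T p \<sigma>) t)"
    using \<Gamma> unfolding locally_constant_at_def by (elim exE conjE)
  have \<Gamma>_eq: "\<Gamma> a' b' = frag_extend (\<lambda>\<sigma>. frag_of (T (a', b') \<sigma>)) c"
    and cycle: "smooth_cycle a' b' (\<Gamma> a' b')" if "(a', b') \<in> V" for a' b'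
    using bspec[OF family that] by auto
  have smooth: "smooth_simplex a' b' (T (a', b') \<sigma>)"
    if "(a', b') \<in> V" "\<sigma> \<in> Poly_Mapping.keys c" for a' b' \<sigma>
    using bspec[OF family that(1)] that(2) by auto
  note cont = bspec[OF cont]
  let ?p = "\<lambda>h. (a + h * d1, b + h * d2)"
  let ?g = "\<lambda>\<xi>. d1 * \<xi> + d2"
  have tend: "(?p \<longlongrightarrow> (a, b)) (nhds 0)"
    by (auto intro!: tendsto_eq_intros filterlim_ident)
  then have evV: "\<forall>\<^sub>F h in nhds 0. ?p h \<in> V"
    using V topological_tendstoD by blast
  then obtain \<rho> where \<rho>: "\<rho> > 0" "\<And>h. h \<in> ball 0 \<rho> \<Longrightarrow> ?p h \<in> V"
    unfolding eventually_nhds_metric by (auto simp: dist_commute)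
  define KK where "KK h \<sigma> t = segment_integral (cubic a b) ?g h (edge (T (a, b) \<sigma>) t) (fst (edge (T (?p h) \<sigma>) t))" for h \<sigma> t
  define deform where "deform \<sigma> J \<longleftrightarrow>
      (\<forall>\<^sub>F h in nhds 0. simplex_integral (wkb (a + h * d1) (b + h * d2) 0) (T (?p h) \<sigma>) =
          J h + (KK h \<sigma> 1 - KK h \<sigma> 0)) \<and>
      (J has_field_derivative simplex_integral (\<lambda>(x, y). (d1 * x + d2) / (2 * y)) (T (a, b) \<sigma>)) (at 0)"
    for \<sigma> J
  have "\<exists>J. deform \<sigma> J" if "\<sigma> \<in> Poly_Mapping.keys c" for \<sigma>
    unfolding deform_def KK_def
    by (rule simplex_period_deformation[of \<rho> a d1 b d2 V "\<lambda>p. T p \<sigma>", OF \<rho> smooth[OF _ that] cont[OF that]])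
      (assumption, assumption, rule exI, erule (1) conjI)
  then obtain J where J: "\<And>\<sigma>. \<sigma> \<in> Poly_Mapping.keys c \<Longrightarrow> deform \<sigma> (J \<sigma>)"
    by metis
  note J = J[unfolded deform_def, THEN conjunct1] J[unfolded deform_def, THEN conjunct2]
  let ?E = "Poly_Mapping.keys c \<times> {0, 1::real}"
  let ?end = "\<lambda>h (\<sigma>, i). edge (T (?p h) \<sigma>) i"
  have end_tendsto: "((\<lambda>h. ?end h e) \<longlongrightarrow> ?end 0 e) (nhds 0)" if "e \<in> ?E" for e
  proof -
    obtain \<sigma> i where e: "e = (\<sigma>, i)" "\<sigma> \<in> Poly_Mapping.keys c" "i \<in> {0..1}" using \<open>e \<in> ?E\<close> by auto
    have "continuous_on V (\<lambda>p. edge (T p \<sigma>) i)"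
    proof -
      have "continuous_on V (\<lambda>p. (p, i))" by (intro continuous_intros)
      from continuous_on_compose2[OF cont[OF e(2)] this] e(3) show ?thesis by (simp add: image_subset_iff)
    qed
    then have "isCont (\<lambda>p. edge (T p \<sigma>) i) (a, b)"
      using V continuous_on_eq_continuous_at by blast
    then have "((\<lambda>h. edge (T (?p h) \<sigma>) i) \<longlongrightarrow> edge (T (a, b) \<sigma>) i) (nhds 0)"
      using isCont_tendsto_compose[OF _ tend] by blast
    then show ?thesis by (simp add: e)
  qed
  \<comment> \<open>Contrapositive of "distinct end points stay distinct under small displacements",
    for the finitely many pairs of ends.\<close>
  have "\<forall>\<^sub>F h in nhds 0. \<forall>e\<in>?E. \<forall>e'\<in>?E. ?end h e = ?end h e' \<longrightarrow> ?end 0 e = ?end 0 e'"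
  proof (intro eventually_ball_finite ballI)
    fix e e' assume e: "e \<in> ?E" "e' \<in> ?E"
    show "\<forall>\<^sub>F h in nhds 0. ?end h e = ?end h e' \<longrightarrow> ?end 0 e = ?end 0 e'"
    proof (cases "?end 0 e = ?end 0 e'")
      case False
      have "((\<lambda>h. ?end h e - ?end h e') \<longlongrightarrow> ?end 0 e - ?end 0 e') (nhds 0)"
        by (intro tendsto_diff end_tendsto e)
      from tendsto_imp_eventually_ne[OF this, of 0] False show ?thesis
        by (auto elim: eventually_mono)
    qed simp
  qed auto
  moreover have "\<forall>\<^sub>F h in nhds 0. \<forall>\<sigma>\<in>Poly_Mapping.keys c.
      simplex_integral (wkb (a + h * d1) (b + h * d2) 0) (T (?p h) \<sigma>) = J \<sigma> h + (KK h \<sigma> 1 - KK h \<sigma> 0)"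
    using J(1) by (intro eventually_ball_finite) auto
  ultimately have "\<forall>\<^sub>F h in nhds 0. Z 0 (a + h * d1) (b + h * d2) (\<Gamma> (a + h * d1) (b + h * d2)) =
      linear_extension (\<lambda>\<sigma>. J \<sigma> h) c"
    using evV
  proof eventually_elim
    case (elim h)
    \<comment> \<open>\<open>\<psi>\<close> sends a displaced end point back to the original one. It
      turns the correction into a function \<open>?H\<close> of the displaced point alone, so the
      closedness of the displaced chain kills the total.\<close>
    obtain \<psi> where \<psi>: "\<And>e. e \<in> ?E \<Longrightarrow> \<psi> (?end h e) = ?end 0 e"
      using ex_factor_through[of ?E "?end h" "?end 0"] elim(1) by blast
    let ?H = "\<lambda>P. segment_integral (cubic a b) ?g h (\<psi> P) (fst P)"
    have KK: "KK h \<sigma> 1 - KK h \<sigma> 0 = ?H (edge (T (?p h) \<sigma>) 1) - ?H (edge (T (?p h) \<sigma>) 0)"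
      if "\<sigma> \<in> Poly_Mapping.keys c" for \<sigma>
      using \<psi>[of "(\<sigma>, 0)"] \<psi>[of "(\<sigma>, 1)"] that by (simp add: KK_def)
    have "linear_extension (\<lambda>\<sigma>. KK h \<sigma> 1 - KK h \<sigma> 0) c =
        linear_extension (\<lambda>\<tau>. ?H (edge \<tau> 1) - ?H (edge \<tau> 0)) (\<Gamma> (a + h * d1) (b + h * d2))"
      unfolding \<Gamma>_eq[OF elim(3)] linear_extension_frag_extend linear_extension_of
      by (rule linear_extension_cong) (rule KK)
    also have "\<dots> = 0"
      by (rule linear_extension_boundary[OF smooth_cycle_boundary[OF cycle[OF elim(3)]]])
    finally have K0: "linear_extension (\<lambda>\<sigma>. KK h \<sigma> 1 - KK h \<sigma> 0) c = 0" .
    have "Z 0 (a + h * d1) (b + h * d2) (\<Gamma> (a + h * d1) (b + h * d2)) =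
        linear_extension (\<lambda>\<sigma>. simplex_integral (wkb (a + h * d1) (b + h * d2) 0) (T (?p h) \<sigma>)) c"
      by (simp add: Z_def chain_integral_linear_extension \<Gamma>_eq[OF elim(3)] linear_extension_frag_extend)
    also have "\<dots> = linear_extension (\<lambda>\<sigma>. J \<sigma> h + (KK h \<sigma> 1 - KK h \<sigma> 0)) c"
      by (rule linear_extension_cong) (use elim(2) in blast)
    also have "\<dots> = linear_extension (\<lambda>\<sigma>. J \<sigma> h) c"
      by (subst linear_extension_linear(1)) (simp add: K0)
    finally show ?case .
  qed
  moreover have "((\<lambda>h. linear_extension (\<lambda>\<sigma>. J \<sigma> h) c) has_field_derivative
      linear_extension (\<lambda>\<sigma>. simplex_integral (\<lambda>(x, y). (d1 * x + d2) / (2 * y)) (T (a, b) \<sigma>)) c) (at 0)"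
    unfolding linear_extension_def by (intro DERIV_sum DERIV_cmult J(2))
  moreover have "chain_integral (\<lambda>(x, y). (d1 * x + d2) / (2 * y)) (\<Gamma> a b) =
      linear_extension (\<lambda>\<sigma>. simplex_integral (\<lambda>(x, y). (d1 * x + d2) / (2 * y)) (T (a, b) \<sigma>)) c"
    by (simp add: chain_integral_linear_extension \<Gamma>_eq[OF V(2)] linear_extension_frag_extend)
  ultimately show ?thesis
    by (simp add: DERIV_cong_ev)
qed

lemma Z_0_partial_derivatives:
  assumes "locally_constant_at a b \<Gamma>"
  shows "((\<lambda>a'. Z 0 a' b (\<Gamma> a' b)) has_field_derivative B_period (\<Gamma> a b) / 2) (at a)"
    and "((\<lambda>b'. Z 0 a b' (\<Gamma> a b')) has_field_derivative A_period (\<Gamma> a b) / 2) (at b)"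
proof -
  have half: "chain_integral (\<lambda>P. 1 / 2 * f P) c = chain_integral f c / 2" for f c
    unfolding chain_integral_linear_extension simplex_integral_scale[abs_def] linear_extension_linear(3)
    by simp
  have "B_period (\<Gamma> a b) / 2 = chain_integral (\<lambda>(x, y). (1 * x + 0) / (2 * y)) (\<Gamma> a b)"
    "A_period (\<Gamma> a b) / 2 = chain_integral (\<lambda>(x, y). (0 * x + 1) / (2 * y)) (\<Gamma> a b)"
    using half[of "\<lambda>(x, y). x / y" "\<Gamma> a b"] half[of "\<lambda>(x, y). 1 / y" "\<Gamma> a b"]
    by (simp_all add: B_period_def A_period_def case_prod_unfold)
  then show "((\<lambda>a'. Z 0 a' b (\<Gamma> a' b)) has_field_derivative B_period (\<Gamma> a b) / 2) (at a)"
    "((\<lambda>b'. Z 0 a b' (\<Gamma> a b')) has_field_derivative A_period (\<Gamma> a b) / 2) (at b)"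
    using Z_0_has_field_derivative[OF assms, of 1 0] Z_0_has_field_derivative[OF assms, of 0 1]
      DERIV_shift[of "\<lambda>a'. Z 0 a' b (\<Gamma> a' b)" _ 0 a] DERIV_shift[of "\<lambda>b'. Z 0 a b' (\<Gamma> a b')" _ 0 b]
    by (simp_all add: add.commute)
qed

section \<open>Hermite reduction\<close>

hide_const (open) up_ring.coeff up_ring.monom Module.smult

section \<open>Weighted-homogeneous polynomials in \<open>a\<close>, \<open>b\<close> and
  \<open>x\<close>\<close>

lemma map_poly_add_hom:
  assumes "\<phi> 0 = 0" "\<And>x y. \<phi> (x + y) = \<phi> x + \<phi> y"
  shows "map_poly \<phi> (p + q) = map_poly \<phi> p + map_poly \<phi> q"
  by (rule poly_eqI) (simp add: coeff_map_poly assms)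

lemma poly_map_poly_mult_hom:
  fixes \<phi> :: "'a :: comm_semiring_0 \<Rightarrow> 'b :: comm_semiring_0"
  assumes "\<phi> 0 = 0" "\<And>x y. \<phi> (x + y) = \<phi> x + \<phi> y" "\<And>x y. \<phi> (x * y) = \<phi> x * \<phi> y"
  shows "poly (map_poly \<phi> (p * q)) z = poly (map_poly \<phi> p) z * poly (map_poly \<phi> q) z"
proof (induction p)
  case (pCons c p)
  then show ?case
    by (simp add: map_poly_add_hom map_poly_pCons map_poly_smult assms algebra_simps)
qed simp

lemma eval_ab_add: "eval_ab (p + q) a b = eval_ab p a b + eval_ab q a b"
  and eval_ab_mult: "eval_ab (p * q) a b = eval_ab p a b * eval_ab q a b"
proof -
  let ?\<phi> = "\<lambda>q. poly (map_poly of_rat q) a :: complex"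
  have hom: "?\<phi> (x + y) = ?\<phi> x + ?\<phi> y" "?\<phi> (x * y) = ?\<phi> x * ?\<phi> y" for x y
    by (simp_all add: map_poly_add_hom poly_map_poly_mult_hom of_rat_add of_rat_mult)
  show "eval_ab (p + q) a b = eval_ab p a b + eval_ab q a b"
    "eval_ab (p * q) a b = eval_ab p a b * eval_ab q a b"
    unfolding eval_ab_def by (simp_all add: map_poly_add_hom poly_map_poly_mult_hom hom)
qed

text \<open>The predicate concerns functions of \<open>(a, b)\<close>, so that one reduction
  produces coefficients valid for all parameters. Weights are integers to keep
  \<open>w - int j\<close> meaningful beyond the degree, where it becomes negative.\<close>

definition homog :: "int \<Rightarrow> (complex \<Rightarrow> complex \<Rightarrow> complex) \<Rightarrow> bool" where
  "homog w f \<longleftrightarrow>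
     (\<exists>p. (\<forall>i j. coeff (coeff p j) i \<noteq> 0 \<longrightarrow> 2 * int i + 3 * int j = w) \<and> f = eval_ab p)"

lemma homog_0: "homog w (\<lambda>a b. 0)"
  unfolding homog_def by (rule exI[of _ 0]) (auto simp: eval_ab_def fun_eq_iff)

lemma homog_add:
  assumes "homog w f" "homog w g"
  shows "homog w (\<lambda>a b. f a b + g a b)"
proof -
  obtain p q where p: "\<And>i j. coeff (coeff p j) i \<noteq> 0 \<Longrightarrow> 2 * int i + 3 * int j = w" "f = eval_ab p"
    and q: "\<And>i j. coeff (coeff q j) i \<noteq> 0 \<Longrightarrow> 2 * int i + 3 * int j = w" "g = eval_ab q"
    using assms by (auto simp: homog_def)
  have "2 * int i + 3 * int j = w" if "coeff (coeff (p + q) j) i \<noteq> 0" for i j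
    using that p(1)[of j i] q(1)[of j i] by (cases "coeff (coeff p j) i = 0") auto
  then show ?thesis
    unfolding homog_def by (intro exI[of _ "p + q"]) (auto simp: eval_ab_add p(2) q(2) fun_eq_iff)
qed

lemma homog_mult:
  assumes "homog v f" "homog w g"
  shows "homog (v + w) (\<lambda>a b. f a b * g a b)"
proof -
  obtain p q where p: "\<And>i j. coeff (coeff p j) i \<noteq> 0 \<Longrightarrow> 2 * int i + 3 * int j = v" "f = eval_ab p"
    and q: "\<And>i j. coeff (coeff q j) i \<noteq> 0 \<Longrightarrow> 2 * int i + 3 * int j = w" "g = eval_ab q"
    using assms by (auto simp: homog_def)
  have "2 * int i + 3 * int j = v + w" if "coeff (coeff (p * q) j) i \<noteq> 0" for i j
  proof -
    have "coeff (coeff (p * q) j) i =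
        (\<Sum>l\<le>j. \<Sum>m\<le>i. coeff (coeff p l) m * coeff (coeff q (j - l)) (i - m))"
      by (simp add: coeff_mult coeff_sum)
    then have "(\<Sum>l\<le>j. \<Sum>m\<le>i. coeff (coeff p l) m * coeff (coeff q (j - l)) (i - m)) \<noteq> 0"
      using that by simp
    then obtain l where l: "l \<in> {..j}" "(\<Sum>m\<le>i. coeff (coeff p l) m * coeff (coeff q (j - l)) (i - m)) \<noteq> 0"
      by (rule sum.not_neutral_contains_not_neutral)
    from l(2) obtain m where "m \<in> {..i}" "coeff (coeff p l) m * coeff (coeff q (j - l)) (i - m) \<noteq> 0"
      by (rule sum.not_neutral_contains_not_neutral)
    then have lm: "l \<le> j" "m \<le> i" "coeff (coeff p l) m * coeff (coeff q (j - l)) (i - m) \<noteq> 0"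
      using l(1) by auto
    then show ?thesis
      using p(1)[of l m] q(1)[of "j - l" "i - m"] by auto
  qed
  then show ?thesis
    unfolding homog_def by (intro exI[of _ "p * q"]) (auto simp: eval_ab_mult p(2) q(2) fun_eq_iff)
qed

lemma homog_of_rat: "homog 0 (\<lambda>a b. of_rat c)"
  unfolding homog_def
  by (rule exI[of _ "[:[:c:]:]"])
    (auto simp: eval_ab_def fun_eq_iff map_poly_pCons coeff_pCons split: nat.splits if_splits)

lemma homog_a: "homog 2 (\<lambda>a b. a)"
  unfolding homog_def
  by (rule exI[of _ "[:[:0, 1:]:]"])
    (auto simp: eval_ab_def fun_eq_iff map_poly_pCons coeff_pCons split: nat.splits if_splits)

lemma homog_b: "homog 3 (\<lambda>a b. b)"
  unfolding homog_def
  by (rule exI[of _ "[:0, 1:]"])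
    (auto simp: eval_ab_def fun_eq_iff map_poly_pCons coeff_pCons split: nat.splits if_splits)

lemma homog_cmult: "homog w f \<Longrightarrow> homog w (\<lambda>a b. of_rat c * f a b)"
  using homog_mult[OF homog_of_rat, of w f c] by simp

lemma homog_sum: "(\<And>i. i \<in> I \<Longrightarrow> homog w (f i)) \<Longrightarrow> homog w (\<lambda>a b. \<Sum>i\<in>I. f i a b)"
  by (induction I rule: infinite_finite_induct) (auto intro: homog_0 homog_add)

text \<open>Every monomial has weight \<open>2 i + 3 j\<close>, which is nonnegative. The degree
  bound that starts the reduction comes from here.\<close>

lemma homog_negative:
  assumes "homog w f" "w < 0"
  shows "f = (\<lambda>a b. 0)"
proof -
  obtain p where p: "\<forall>i j. coeff (coeff p j) i \<noteq> 0 \<longrightarrow> 2 * int i + 3 * int j = w" "f = eval_ab p"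
    using assms(1) by (auto simp: homog_def)
  have "coeff (coeff p j) i = 0" for i j
    using p(1)[rule_format, of j i] assms(2) by linarith
  then have "p = 0" by (simp add: poly_eq_iff)
  then show ?thesis by (simp add: p(2) eval_ab_def fun_eq_iff)
qed

text \<open>The variable of the polynomial has weight 1, as \<open>x\<close> does in \<open>x\<^sup>3 + a x + b\<close>.\<close>

definition homog_poly :: "int \<Rightarrow> (complex \<Rightarrow> complex \<Rightarrow> complex poly) \<Rightarrow> bool" where
  "homog_poly w F \<longleftrightarrow> (\<forall>j. homog (w - int j) (\<lambda>a b. coeff (F a b) j))"

lemma homog_poly_add:
  "homog_poly w F \<Longrightarrow> homog_poly w G \<Longrightarrow> homog_poly w (\<lambda>a b. F a b + G a b)"
  by (simp add: homog_poly_def homog_add)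

lemma homog_poly_0: "homog_poly w (\<lambda>a b. 0)"
  by (simp add: homog_poly_def homog_0)

lemma homog_poly_sum: "(\<And>i. i \<in> I \<Longrightarrow> homog_poly w (F i)) \<Longrightarrow> homog_poly w (\<lambda>a b. \<Sum>i\<in>I. F i a b)"
  unfolding homog_poly_def coeff_sum by (intro allI homog_sum) simp

lemma homog_poly_mult:
  assumes "homog_poly v F" "homog_poly w G"
  shows "homog_poly (v + w) (\<lambda>a b. F a b * G a b)"
  unfolding homog_poly_def coeff_mult
proof (intro allI homog_sum)
  fix j i :: nat assume "i \<in> {..j}"
  then have w: "v + w - int j = v - int i + (w - int (j - i))" by simp
  have "homog (v - int i) (\<lambda>a b. coeff (F a b) i)"
    "homog (w - int (j - i)) (\<lambda>a b. coeff (G a b) (j - i))"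
    using assms unfolding homog_poly_def by blast+
  from homog_mult[OF this]
  have "homog (v - int i + (w - int (j - i))) (\<lambda>a b. coeff (F a b) i * coeff (G a b) (j - i))" .
  then show "homog (v + w - int j) (\<lambda>a b. coeff (F a b) i * coeff (G a b) (j - i))"
    unfolding w .
qed

lemma homog_poly_const: "homog w f \<Longrightarrow> homog_poly w (\<lambda>a b. [:f a b:])"
  unfolding homog_poly_def
proof
  fix j assume "homog w f"
  then show "homog (w - int j) (\<lambda>a b. coeff [:f a b:] j)"
    by (cases j) (auto simp: homog_0)
qed

lemma homog_poly_smult: "homog v f \<Longrightarrow> homog_poly w F \<Longrightarrow> homog_poly (v + w) (\<lambda>a b. smult (f a b) (F a b))"
  using homog_poly_mult[OF homog_poly_const, of v f w F] by simp

text \<open>The polynomials in \<open>x\<close> have complex coefficients, so rationality is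
  certified constant by constant: \<open>r\<close> is the rational behind \<open>c\<close>.\<close>

lemma homog_poly_smult_of_rat:
  assumes "homog_poly w F" "of_rat r = c"
  shows "homog_poly w (\<lambda>a b. smult c (F a b))"
  using homog_poly_smult[OF homog_of_rat[of r] assms(1)] assms(2) by simp

lemma homog_poly_pCons:
  assumes "homog w f" "homog_poly (w - 1) F"
  shows "homog_poly w (\<lambda>a b. pCons (f a b) (F a b))"
  unfolding homog_poly_def
proof
  fix j show "homog (w - int j) (\<lambda>a b. coeff (pCons (f a b) (F a b)) j)"
  proof (cases j)
    case (Suc i)
    have "w - 1 - int i = w - int j" by (simp add: Suc)
    moreover have "homog (w - 1 - int i) (\<lambda>a b. coeff (F a b) i)"
      using assms(2) unfolding homog_poly_def by blast
    ultimately show ?thesis by (simp only: Suc coeff_pCons_Suc)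
  qed (use assms(1) in simp)
qed

lemma homog_poly_monom:
  assumes "homog v f"
  shows "homog_poly (v + int m) (\<lambda>a b. monom (f a b) m)"
  unfolding homog_poly_def
proof
  fix j show "homog (v + int m - int j) (\<lambda>a b. coeff (monom (f a b) m) j)"
    using assms by (cases "j = m") (auto simp: homog_0)
qed

lemma homog_poly_pderiv:
  assumes "homog_poly w F"
  shows "homog_poly (w - 1) (\<lambda>a b. pderiv (F a b))"
  unfolding homog_poly_def coeff_pderiv
proof
  fix j
  have "homog (w - int (Suc j)) (\<lambda>a b. coeff (F a b) (Suc j))"
    using assms unfolding homog_poly_def by blast
  then have "homog (w - int (Suc j)) (\<lambda>a b. of_rat (of_nat (Suc j)) * coeff (F a b) (Suc j))"
    by (rule homog_cmult)
  moreover have "w - int (Suc j) = w - 1 - int j" by simp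
  ultimately show "homog (w - 1 - int j) (\<lambda>a b. of_nat (Suc j) * coeff (F a b) (Suc j))"
    by (simp only: of_rat_of_nat_eq)
qed

section \<open>Polynomial numerators of the WKB coefficients\<close>

definition cubic_poly :: "complex \<Rightarrow> complex \<Rightarrow> complex poly" where
  "cubic_poly a b = [:b, a, 0, 1:]"

lemma poly_cubic_poly [simp]: "poly (cubic_poly a b) x = cubic a b x"
  by (simp add: cubic_poly_def cubic_def algebra_simps power3_eq_cube)

lemma poly_pderiv_cubic_poly [simp]: "poly (pderiv (cubic_poly a b)) x = 3 * x ^ 2 + a"
  by (simp add: cubic_poly_def pderiv_pCons algebra_simps power2_eq_square)

lemma coeff_cubic_poly_ge_3: "coeff (cubic_poly a b) (3 + l) = (if l = 0 then 1 else 0)"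
  by (cases l) (simp_all add: cubic_poly_def numeral_3_eq_3)

lemma homog_poly_cubic_poly: "homog_poly 3 cubic_poly"
proof -
  have "homog 0 (\<lambda>a b. 1)" using homog_of_rat[of 1] by simp
  then show ?thesis
    unfolding cubic_poly_def[abs_def]
    by (auto intro!: homog_poly_pCons homog_a homog_b homog_0 homog_poly_0)
qed

text \<open>On the curve \<open>s\<^sub>n = wkb_poly a b n / y^(3 n - 1)\<close>.\<close>

fun wkb_poly :: "complex \<Rightarrow> complex \<Rightarrow> nat \<Rightarrow> complex poly" where
  "wkb_poly a b 0 = 1"
| "wkb_poly a b (Suc n) = smult (- 1 / 2)
     (cubic_poly a b * pderiv (wkb_poly a b n)
      + smult ((1 - 3 * of_nat n) / 2) (wkb_poly a b n * pderiv (cubic_poly a b))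
      + (\<Sum>i=1..n. wkb_poly a b i * wkb_poly a b (Suc n - i)))"

text \<open>The cubic has weight 3 and differentiation costs 1, so each step of the recursion gains
  2; the products agree, as \<open>2 i + 2 (m + 1 - i) = 2 (m + 1)\<close>.\<close>

lemma homog_poly_wkb_poly: "homog_poly (2 * int n) (\<lambda>a b. wkb_poly a b n)"
proof (induction n rule: less_induct)
  case (less n)
  show ?case
  proof (cases n)
    case 0
    then show ?thesis
      using homog_poly_const[OF homog_of_rat, of 1] by (simp add: one_pCons)
  next
    case (Suc m)
    have Pm: "homog_poly (2 * int m) (\<lambda>a b. wkb_poly a b m)"
      using less Suc by simp
    have 1: "homog_poly (2 * int n) (\<lambda>a b. cubic_poly a b * pderiv (wkb_poly a b m))"
      using homog_poly_mult[OF homog_poly_cubic_poly homog_poly_pderiv[OF Pm]] Suc by simp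
    have "homog_poly (2 * int n) (\<lambda>a b. wkb_poly a b m * pderiv (cubic_poly a b))"
      using homog_poly_mult[OF Pm homog_poly_pderiv[OF homog_poly_cubic_poly]] Suc
      by (simp add: algebra_simps)
    then have 2: "homog_poly (2 * int n)
        (\<lambda>a b. smult ((1 - 3 * of_nat m) / 2) (wkb_poly a b m * pderiv (cubic_poly a b)))"
      by (rule homog_poly_smult_of_rat[where r = "(1 - 3 * of_nat m) / 2"])
        (simp add: of_rat_divide of_rat_diff of_rat_mult)
    have 3: "homog_poly (2 * int n) (\<lambda>a b. \<Sum>i=1..m. wkb_poly a b i * wkb_poly a b (Suc m - i))"
    proof (rule homog_poly_sum)
      fix i assume i: "i \<in> {1..m}"
      then have "i < n" "Suc m - i < n" using Suc by auto
      then have "homog_poly (2 * int i + 2 * int (Suc m - i)) (\<lambda>a b. wkb_poly a b i * wkb_poly a b (Suc m - i))"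
        by (intro homog_poly_mult less.IH)
      moreover have "2 * int i + 2 * int (Suc m - i) = 2 * int n" using i Suc by auto
      ultimately show "homog_poly (2 * int n) (\<lambda>a b. wkb_poly a b i * wkb_poly a b (Suc m - i))"
        by simp
    qed
    have "homog_poly (2 * int n) (\<lambda>a b. wkb_poly a b (Suc m))"
      unfolding wkb_poly.simps
      by (rule homog_poly_smult_of_rat[OF homog_poly_add[OF homog_poly_add[OF 1 2] 3], where r = "- 1 / 2"])
        (simp add: of_rat_divide of_rat_minus)
    then show ?thesis by (simp only: Suc)
  qed
qed

text \<open>Differentiating \<open>p r^(1 - 3 m)\<close> with \<open>r' = Q' / (2 r)\<close> gives
  \<open>(p' Q + (1 - 3 m)/2 p Q') / r^(3 m + 1)\<close>. The products in the recursion have the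
  same denominator, and the final division by \<open>2 r\<close> makes it
  \<open>r^(3 m + 2)\<close>. The factor is written \<open>r x / r x ^ (3 * n)\<close> because
  \<open>3 * n - 1\<close> would be truncated at \<open>n = 0\<close>.\<close>

lemma riccati_eq_wkb_poly:
  assumes U: "open U" and r: "\<And>\<xi>. \<xi> \<in> U \<Longrightarrow> r \<xi> \<noteq> 0" "\<And>\<xi>. \<xi> \<in> U \<Longrightarrow> r \<xi> ^ 2 = cubic a b \<xi>"
    and dr: "\<And>\<xi>. \<xi> \<in> U \<Longrightarrow> (r has_field_derivative (3 * \<xi> ^ 2 + a) / (2 * r \<xi>)) (at \<xi>)"
    and x: "x \<in> U"
  shows "riccati r n x = poly (wkb_poly a b n) x * r x / r x ^ (3 * n)"
  using x
proof (induction n arbitrary: x rule: less_induct)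
  case (less n)
  show ?case
  proof (cases n)
    case (Suc m)
    let ?p = "wkb_poly a b m" and ?R = "r x"
    let ?N = "poly (pderiv ?p) x * cubic a b x + (1 - 3 * of_nat m) / 2 * poly ?p x * (3 * x ^ 2 + a)"
    note R = r(1)[OF less.prems]
    have "((\<lambda>\<xi>. 1 / r \<xi> ^ (3 * m)) has_field_derivative
        - of_nat (3 * m) / ?R ^ (3 * m + 1) * ((3 * x ^ 2 + a) / (2 * ?R))) (at x)"
      by (rule DERIV_chain2[OF has_field_derivative_inverse_power[OF R] dr[OF less.prems]])
    from DERIV_mult[OF DERIV_mult[OF poly_DERIV[of ?p x] dr[OF less.prems]] this]
    have "((\<lambda>\<xi>. poly ?p \<xi> * r \<xi> * (1 / r \<xi> ^ (3 * m))) has_field_derivative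
        (poly (pderiv ?p) x * ?R + (3 * x ^ 2 + a) / (2 * ?R) * poly ?p x) * (1 / ?R ^ (3 * m)) +
        - of_nat (3 * m) / ?R ^ (3 * m + 1) * ((3 * x ^ 2 + a) / (2 * ?R)) * (poly ?p x * ?R)) (at x)" .
    moreover have "(poly (pderiv ?p) x * ?R + (3 * x ^ 2 + a) / (2 * ?R) * poly ?p x) * (1 / ?R ^ (3 * m)) +
        - of_nat (3 * m) / ?R ^ (3 * m + 1) * ((3 * x ^ 2 + a) / (2 * ?R)) * (poly ?p x * ?R) =
        ?N / ?R ^ (3 * m + 1)"
    proof -
      define Y where "Y = ?R ^ (3 * m)"
      have "Y \<noteq> 0" using R by (simp add: Y_def)
      then show ?thesis
        unfolding power_add r(2)[OF less.prems, symmetric] Y_def[symmetric] using R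
        by (simp add: divide_simps) (simp add: algebra_simps power2_eq_square)
    qed
    ultimately have "((\<lambda>\<xi>. poly ?p \<xi> * r \<xi> / r \<xi> ^ (3 * m)) has_field_derivative ?N / ?R ^ (3 * m + 1)) (at x)"
      by simp
    then have "(riccati r m has_field_derivative ?N / ?R ^ (3 * m + 1)) (at x)"
      by (rule has_field_derivative_transform_within_open[OF _ U less.prems])
        (use less.IH[of m] Suc in simp)
    then have d: "deriv (riccati r m) x = ?N / ?R ^ (3 * m + 1)"
      by (rule DERIV_imp_deriv)
    have s: "(\<Sum>i=1..m. riccati r i x * riccati r (Suc m - i) x) =
        (\<Sum>i=1..m. poly (wkb_poly a b i) x * poly (wkb_poly a b (Suc m - i)) x) / ?R ^ (3 * m + 1)"
      unfolding sum_divide_distrib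
    proof (rule sum.cong[OF refl])
      fix i assume i: "i \<in> {1..m}"
      have AB: "?R ^ (3 * i) * ?R ^ (3 * (Suc m - i)) = ?R ^ (3 * m + 1) * (?R * ?R)"
      proof -
        have "3 * i + 3 * (Suc m - i) = 3 * m + 1 + 2" using i by (simp only: atLeastAtMost_iff) arith
        then show ?thesis by (metis power_add power2_eq_square)
      qed
      show "riccati r i x * riccati r (Suc m - i) x =
          poly (wkb_poly a b i) x * poly (wkb_poly a b (Suc m - i)) x / ?R ^ (3 * m + 1)"
      proof -
        let ?A = "?R ^ (3 * i)" and ?B = "?R ^ (3 * (Suc m - i))"
        have "riccati r i x * riccati r (Suc m - i) x =
            (poly (wkb_poly a b i) x * ?R / ?A) * (poly (wkb_poly a b (Suc m - i)) x * ?R / ?B)"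
          using less.IH[of i x] less.IH[of "Suc m - i" x] i Suc less.prems by simp
        also have "\<dots> = poly (wkb_poly a b i) x * poly (wkb_poly a b (Suc m - i)) x * (?R * ?R) / (?A * ?B)"
          by simp
        also have "\<dots> = poly (wkb_poly a b i) x * poly (wkb_poly a b (Suc m - i)) x / ?R ^ (3 * m + 1)"
          unfolding AB using R by simp
        finally show ?thesis .
      qed
    qed
    have "riccati r n x = - (?N / ?R ^ (3 * m + 1) +
        (\<Sum>i=1..m. poly (wkb_poly a b i) x * poly (wkb_poly a b (Suc m - i)) x) / ?R ^ (3 * m + 1)) / (2 * ?R)"
      unfolding Suc riccati.simps d s ..
    also have "\<dots> = poly (wkb_poly a b n) x / (?R ^ (3 * m + 1) * ?R)"
      unfolding Suc wkb_poly.simps using R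
      by (simp add: poly_sum divide_simps)
    also have "\<dots> = poly (wkb_poly a b n) x * ?R / ?R ^ (3 * n)"
      using R by (simp add: Suc power_add power3_eq_cube)
    finally show ?thesis .
  qed simp
qed

lemma wkb_eq_wkb_poly:
  assumes "y ^ 2 = cubic a b x" "y \<noteq> 0"
  shows "wkb a b n (x, y) = poly (wkb_poly a b n) x * y / y ^ (3 * n)"
proof -
  let ?r = "\<lambda>\<xi>. branch y (cubic a b \<xi>)"
  \<comment> \<open>The recursion differentiates, so the root is needed on an open set around
    \<open>x\<close>; on this one it avoids the cut.\<close>
  let ?U = "{\<xi>. norm (cubic a b \<xi> / y ^ 2 - 1) < 1}"
  have "continuous_on UNIV (cubic a b)"
    using holomorphic_on_cubic holomorphic_on_imp_continuous_on by blast
  then have "open ?U"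
    using assms(2) by (intro open_Collect_less continuous_intros) auto
  moreover have "(?r has_field_derivative (3 * \<xi> ^ 2 + a) / (2 * ?r \<xi>)) (at \<xi>)" if "\<xi> \<in> ?U" for \<xi>
  proof -
    have "(cubic a b has_field_derivative 3 * \<xi> ^ 2 + a) (at \<xi>)"
      unfolding cubic_def[abs_def] by (auto intro!: derivative_eq_intros)
    from DERIV_chain2[OF has_field_derivative_branch this] assms(2) that show ?thesis by simp
  qed
  moreover have "?r \<xi> \<noteq> 0" if "\<xi> \<in> ?U" for \<xi>
    using branch_nonzero[OF assms(2)] that by simp
  moreover have "x \<in> ?U" using assms by (simp add: assms(1)[symmetric])
  ultimately have "riccati ?r n x = poly (wkb_poly a b n) x * ?r x / ?r x ^ (3 * n)"
    using branch_square[OF assms(2)] by (intro riccati_eq_wkb_poly[of ?U]) auto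
  moreover have "?r x = y" using branch_self[OF assms(2)] assms(1) by simp
  ultimately show ?thesis by (simp only: wkb_def branch_def[symmetric] prod.case)
qed

text \<open>The form \<open>d (G / y^(2 c))\<close> is \<open>exact_poly c Q G / y^(2 c + 2) dx\<close> on the curve \<open>y\<^sup>2 = Q\<close>.\<close>

definition exact_poly :: "complex \<Rightarrow> complex poly \<Rightarrow> complex poly \<Rightarrow> complex poly" where
  "exact_poly c Q G = pderiv G * Q - smult c (G * pderiv Q)"

lemma exact_poly_add: "exact_poly c Q (G + H) = exact_poly c Q G + exact_poly c Q H"
  by (simp add: exact_poly_def pderiv_add algebra_simps smult_add_right)

lemma exact_poly_smult: "exact_poly c Q (smult k G) = smult k (exact_poly c Q G)"
  by (simp add: exact_poly_def pderiv_smult algebra_simps smult_diff_right)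

text \<open>On the curve \<open>Q G / y^(2 c + 2)\<close> and \<open>G / y^(2 c)\<close> are the
  same function, hence have the same differential.\<close>

lemma exact_poly_shift: "exact_poly (c + 1) Q (Q * G) = Q * exact_poly c Q G"
  by (simp add: exact_poly_def pderiv_mult algebra_simps smult_add_left)

text \<open>For forms \<open>F dx / y\<close>. The differential of \<open>x^m y\<close> has
  numerator with leading term \<open>(m + 3/2) x^(m + 2)\<close>, so a suitable multiple removes the
  top coefficient whenever the degree is at least 2. What survives is linear in
  \<open>x\<close>.\<close>

lemma reduce_degree:
  fixes F :: "complex \<Rightarrow> complex \<Rightarrow> complex poly"
  assumes "homog_poly w F" "\<And>a b i. i \<ge> n \<Longrightarrow> coeff (F a b) i = 0"
  shows "\<exists>\<alpha> \<beta> G. homog w \<alpha> \<and> homog (w - 1) \<beta> \<and>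
    (\<forall>a b. F a b = [:\<alpha> a b, \<beta> a b:] + exact_poly (- 1 / 2) (cubic_poly a b) (G a b))"
  using assms
proof (induction n arbitrary: F)
  case 0
  then have "F a b = 0" for a b by (simp add: poly_eq_iff)
  then show ?case
    by (intro exI[of _ "\<lambda>a b. 0"]) (simp add: homog_0 exact_poly_def)
next
  case (Suc n)
  show ?case
  proof (cases "n < 2")
    case True
    then have "F a b = [:coeff (F a b) 0, coeff (F a b) 1:]" for a b
      using Suc.prems(2) by (auto simp: poly_eq_iff coeff_pCons split: nat.splits)
    moreover have "homog w (\<lambda>a b. coeff (F a b) 0)" "homog (w - 1) (\<lambda>a b. coeff (F a b) 1)"
      using Suc.prems(1) unfolding homog_poly_def by (metis of_nat_0 diff_zero, metis of_nat_1)
    ultimately show ?thesis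
      by (intro exI[of _ "\<lambda>a b. coeff (F a b) 0"] exI[of _ "\<lambda>a b. coeff (F a b) 1"]
          exI[of _ "\<lambda>a b. 0"]) (simp add: exact_poly_def)
  next
    case False
    then obtain m where n: "n = m + 2" by (metis add.commute le_Suc_ex not_less)
    define r where "r = (of_nat m + 3 / 2 :: rat)"
    have r: "of_rat r = (of_nat m + 3 / 2 :: complex)"
      by (simp add: r_def of_rat_add of_rat_divide)
    have r0: "of_nat m + 3 / 2 \<noteq> (0 :: complex)"
      unfolding r[symmetric] of_rat_eq_0_iff
      by (metis add_nonneg_pos less_irrefl of_nat_0_le_iff r_def zero_less_divide_iff zero_less_numeral)
    define c where "c a b = of_rat (1 / r) * coeff (F a b) n" for a b
    have c: "homog (w - int n) c"
      using Suc.prems(1) unfolding c_def[abs_def] homog_poly_def by (intro homog_cmult) auto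
    define F' where "F' a b = F a b + smult (- 1) (cubic_poly a b * pderiv (monom (c a b) m)) +
      smult (- 1 / 2) (monom (c a b) m * pderiv (cubic_poly a b))" for a b
    have G0: "homog_poly (w - int n + int m) (\<lambda>a b. monom (c a b) m)"
      by (rule homog_poly_monom[OF c])
    have F'w: "homog_poly w F'"
      unfolding F'_def[abs_def]
    proof (intro homog_poly_add Suc.prems(1))
      have "homog_poly w (\<lambda>a b. cubic_poly a b * pderiv (monom (c a b) m))"
        using homog_poly_mult[OF homog_poly_cubic_poly homog_poly_pderiv[OF G0]] n by simp
      then show "homog_poly w (\<lambda>a b. smult (- 1) (cubic_poly a b * pderiv (monom (c a b) m)))"
        by (rule homog_poly_smult_of_rat[where r = "- 1"]) simp
      have "homog_poly w (\<lambda>a b. monom (c a b) m * pderiv (cubic_poly a b))"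
        using homog_poly_mult[OF G0 homog_poly_pderiv[OF homog_poly_cubic_poly]] n by simp
      then show "homog_poly w (\<lambda>a b. smult (- 1 / 2) (monom (c a b) m * pderiv (cubic_poly a b)))"
        by (rule homog_poly_smult_of_rat[where r = "- 1 / 2"]) (simp add: of_rat_divide of_rat_minus)
    qed
    have F'n: "coeff (F' a b) i = 0" if "i \<ge> n" for a b i
    proof -
      have 1: "coeff (cubic_poly a b * pderiv (monom (c a b) m)) i = (if i = n then of_nat m * c a b else 0)"
      proof (cases m)
        case (Suc l)
        then have "l + 3 \<le> i" using that n by simp
        then obtain l' where "i = l + 3 + l'" using le_Suc_ex by blast
        then have i: "i = l + (3 + l')" by simp
        have "pderiv (monom (c a b) m) = monom (of_nat m * c a b) l"
          by (simp add: pderiv_monom Suc)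
        then have "coeff (cubic_poly a b * pderiv (monom (c a b) m)) i =
            of_nat m * c a b * coeff (cubic_poly a b) (3 + l')"
          by (simp only: mult.commute[of "cubic_poly a b"] coeff_monom_mult i) simp
        moreover have "i = n \<longleftrightarrow> l' = 0" by (auto simp: i n Suc)
        ultimately show ?thesis by (simp only: coeff_cubic_poly_ge_3) simp
      qed (simp add: pderiv_monom)
      have "m + 2 \<le> i" using that n by simp
      then obtain l' where "i = m + 2 + l'" using le_Suc_ex by blast
      then have i: "i = m + (2 + l')" by simp
      have "coeff (monom (c a b) m * pderiv (cubic_poly a b)) i = c a b * coeff (pderiv (cubic_poly a b)) (2 + l')"
        by (simp only: coeff_monom_mult i) simp
      moreover have "coeff (pderiv (cubic_poly a b)) (2 + l') = (if l' = 0 then 3 else 0)"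
        using coeff_cubic_poly_ge_3[of a b l'] by (simp add: coeff_pderiv numeral_3_eq_3)
      moreover have "i = n \<longleftrightarrow> l' = 0" by (auto simp: i n)
      ultimately have 2: "coeff (monom (c a b) m * pderiv (cubic_poly a b)) i = (if i = n then 3 * c a b else 0)"
        by simp
      have "coeff (F a b) n = (of_nat m + 3 / 2) * c a b"
        using r0 by (simp add: c_def of_rat_divide r)
      then show ?thesis
        using 1 2 Suc.prems(2)[of i a b] that by (simp add: F'_def algebra_simps)
    qed
    from Suc.IH[OF F'w F'n] obtain \<alpha> \<beta> G where "homog w \<alpha>" "homog (w - 1) \<beta>"
      and F': "\<And>a b. F' a b = [:\<alpha> a b, \<beta> a b:] + exact_poly (- 1 / 2) (cubic_poly a b) (G a b)"
      by blast
    moreover have "F a b = [:\<alpha> a b, \<beta> a b:] +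
        exact_poly (- 1 / 2) (cubic_poly a b) (G a b + monom (c a b) m)" for a b
      using F'[of a b] unfolding exact_poly_add by (simp add: F'_def exact_poly_def algebra_simps)
    ultimately show ?thesis
      by (intro exI[of _ \<alpha>] exI[of _ \<beta>] exI[of _ "\<lambda>a b. G a b + monom (c a b) m"] conjI allI)
  qed
qed

text \<open>The resultant identity \<open>U Q + V Q' = \<Delta>\<close> lowers the order of the pole by one.\<close>

lemma disc_bezout:
  "[:27 * b, - 18 * a:] * cubic_poly a b + [:4 * a ^ 2, - 9 * b, 6 * a:] * pderiv (cubic_poly a b) = [:disc a b:]"
  by (simp add: cubic_poly_def pderiv_pCons disc_def algebra_simps power2_eq_square power3_eq_cube)

text \<open>For forms \<open>F dx / y^(2 j + 1)\<close>. One step trades the pole for a factor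
  \<open>disc a b\<close> and raises the weight by 3: \<open>U\<close> has weight 3, and
  \<open>V\<close> has weight 4 but is followed by a derivative.\<close>

lemma reduce_pole:
  assumes "homog_poly w F"
  shows "\<exists>\<alpha> \<beta> G. homog (w + 3 * int j) \<alpha> \<and> homog (w + 3 * int j - 1) \<beta> \<and>
    (\<forall>a b. smult (disc a b ^ j) (F a b) =
       [:\<alpha> a b, \<beta> a b:] * cubic_poly a b ^ j +
       exact_poly (of_nat j - 1 / 2) (cubic_poly a b) (G a b))"
  using assms
proof (induction j arbitrary: w F)
  case 0
  \<comment> \<open>The coefficient of \<open>x^i\<close> has weight \<open>w - i\<close>, negative
    for these \<open>i\<close>. This bounds the degree uniformly in \<open>(a, b)\<close>.\<close>
  have "coeff (F a b) i = 0" if "i \<ge> nat w + 1" for a b i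
  proof -
    have "(\<lambda>a b. coeff (F a b) i) = (\<lambda>a b. 0)"
      using 0 that by (intro homog_negative[of "w - int i"]) (auto simp: homog_poly_def)
    then show ?thesis by meson
  qed
  from reduce_degree[OF 0 this] show ?case by simp
next
  case (Suc j)
  define c where "c = (of_nat j + 1 / 2 :: complex)"
  define r where "r = (of_nat j + 1 / 2 :: rat)"
  have r: "of_rat r = c" by (simp add: r_def c_def of_rat_add of_rat_divide)
  have "r > 0" unfolding r_def by (intro add_nonneg_pos) auto
  then have c0: "c \<noteq> 0" using r by (metis less_irrefl of_rat_eq_0_iff)
  define U V where "U = (\<lambda>a b. [:27 * b, - 18 * a:] :: complex poly)"
    and "V = (\<lambda>a b. [:4 * a ^ 2, - 9 * b, 6 * a:] :: complex poly)"
  have num: "homog v (\<lambda>a b. numeral k * f a b)" "homog v (\<lambda>a b. - f a b)" if "homog v f" for v k f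
    using homog_cmult[OF that, of "numeral k"] homog_cmult[OF that, of "- 1"] by simp_all
  have U: "homog_poly 3 U"
    unfolding U_def by (auto intro!: homog_poly_pCons homog_poly_0 num homog_a homog_b)
  have V: "homog_poly 4 V"
    unfolding V_def power2_eq_square
    using homog_mult[OF homog_a homog_a] by (auto intro!: homog_poly_pCons homog_poly_0 num homog_a homog_b)
  \<comment> \<open>Integration by parts: \<open>disc * F = F U Q + F V Q'\<close>, and modulo the
    differential of a multiple of \<open>F V / y^(2 c)\<close> the term \<open>F V Q'\<close> may be
    replaced by \<open>(F V)' Q / c\<close>. Both terms are then divisible by \<open>Q\<close>,
    which lowers the pole.\<close>
  define F1 where "F1 a b = F a b * U a b + smult (1 / c) (pderiv (F a b * V a b))" for a b
  have "homog_poly (w + 3) F1"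
    unfolding F1_def[abs_def]
  proof (intro homog_poly_add homog_poly_smult_of_rat[where r = "1 / r"])
    show "homog_poly (w + 3) (\<lambda>a b. F a b * U a b)"
      by (rule homog_poly_mult[OF Suc.prems U])
    show "homog_poly (w + 3) (\<lambda>a b. pderiv (F a b * V a b))"
      using homog_poly_pderiv[OF homog_poly_mult[OF Suc.prems V]] by (simp add: add.commute)
  qed (simp add: of_rat_divide r)
  moreover have w: "w + 3 + 3 * int j = w + 3 * int (Suc j)" by simp
  ultimately obtain \<alpha> \<beta> G
    where "homog (w + 3 * int (Suc j)) \<alpha>" "homog (w + 3 * int (Suc j) - 1) \<beta>"
      and G: "\<And>a b. smult (disc a b ^ j) (F1 a b) =
       [:\<alpha> a b, \<beta> a b:] * cubic_poly a b ^ j +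
       exact_poly (of_nat j - 1 / 2) (cubic_poly a b) (G a b)"
    using Suc.IH[of "w + 3" F1, unfolded w] by blast
  moreover have "smult (disc a b ^ Suc j) (F a b) =
       [:\<alpha> a b, \<beta> a b:] * cubic_poly a b ^ Suc j +
       exact_poly (of_nat (Suc j) - 1 / 2) (cubic_poly a b)
         (cubic_poly a b * G a b + smult (disc a b ^ j) (smult (- 1 / c) (F a b * V a b)))" for a b
  proof -
    let ?Q = "cubic_poly a b"
    have c': "of_nat (Suc j) - 1 / 2 = (of_nat j - 1 / 2) + (1::complex)" "of_nat (Suc j) - 1 / 2 = c"
      by (simp_all add: c_def)
    have "exact_poly c ?Q (smult (- 1 / c) (F a b * V a b)) =
        F a b * V a b * pderiv ?Q - smult (1 / c) (pderiv (F a b * V a b)) * ?Q"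
      unfolding exact_poly_smult unfolding exact_poly_def using c0
      by (simp add: smult_diff_right)
    also have "\<dots> = F a b * (U a b * ?Q + V a b * pderiv ?Q) - ?Q * F1 a b"
      by (simp add: F1_def algebra_simps)
    also have "\<dots> = smult (disc a b) (F a b) - ?Q * F1 a b"
      unfolding U_def V_def disc_bezout by simp
    finally have E: "exact_poly c ?Q (smult (- 1 / c) (F a b * V a b)) = smult (disc a b) (F a b) - ?Q * F1 a b" .
    \<comment> \<open>The reduction of \<open>F1\<close> lives one pole order lower, so it is
      multiplied by \<open>Q\<close>; \<open>exact_poly_shift\<close> keeps its exact part
      exact.\<close>
    have X: "exact_poly (of_nat (Suc j) - 1 / 2) ?Q (?Q * G a b) = ?Q * (smult (disc a b ^ j) (F1 a b) - [:\<alpha> a b, \<beta> a b:] * ?Q ^ j)"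
      unfolding c'(1) exact_poly_shift G by simp
    have Y: "exact_poly (of_nat (Suc j) - 1 / 2) ?Q (smult (disc a b ^ j) (smult (- 1 / c) (F a b * V a b))) =
        smult (disc a b ^ j) (smult (disc a b) (F a b) - ?Q * F1 a b)"
      unfolding exact_poly_smult[of _ _ "disc a b ^ j"] unfolding c'(2) E ..
    show ?thesis
      unfolding exact_poly_add X Y by (simp add: algebra_simps smult_diff_right)
  qed
  ultimately show ?case
    by (intro exI[of _ \<alpha>] exI[of _ \<beta>] exI[of _ "\<lambda>a b. cubic_poly a b * G a b +
        smult (disc a b ^ j) (smult (- 1 / c) (F a b * V a b))"] conjI allI)
qed

section \<open>Periods of the even coefficients\<close>

lemma simplex_integral_wkb_even:
  assumes \<sigma>: "smooth_simplex a b \<sigma>" and D: "disc a b \<noteq> 0" and k: "k \<ge> 1"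
    and red: "smult (disc a b ^ (3 * k - 1)) (wkb_poly a b (2 * k)) =
       [:\<alpha>, \<beta>:] * cubic_poly a b ^ (3 * k - 1) +
       exact_poly (of_nat (3 * k - 1) - 1 / 2) (cubic_poly a b) G"
  defines "H \<equiv> \<lambda>(x, y). poly G x / y ^ (6 * k - 3) / disc a b ^ (3 * k - 1)"
  shows "simplex_integral (wkb a b (2 * k)) \<sigma> =
    \<alpha> / disc a b ^ (3 * k - 1) * simplex_integral (\<lambda>(x, y). 1 / y) \<sigma> +
    \<beta> / disc a b ^ (3 * k - 1) * simplex_integral (\<lambda>(x, y). x / y) \<sigma> +
    (H (edge \<sigma> 1) - H (edge \<sigma> 0))"
proof -
  let ?D = "disc a b ^ (3 * k - 1)"
  let ?v = "\<lambda>t. vector_derivative (fst \<circ> edge \<sigma>) (at t within {0..1})"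
  let ?E = "\<lambda>(x, y). (poly (pderiv G) x * cubic a b x -
    of_nat (6 * k - 3) / 2 * poly G x * (3 * x ^ 2 + a)) / y ^ (6 * k - 3 + 2)"
  \<comment> \<open>With \<open>j = 3 k - 1\<close> the denominator \<open>y^(2 j + 1)\<close> is
    \<open>y^(6 k - 1)\<close>, and the primitive \<open>G / y^(2 j - 1)\<close> has exponent
    \<open>6 k - 3\<close>.\<close>
  have E: "((\<lambda>t. ?E (edge \<sigma> t) * ?v t) has_integral
      poly G (fst (edge \<sigma> 1)) / snd (edge \<sigma> 1) ^ (6 * k - 3) -
      poly G (fst (edge \<sigma> 0)) / snd (edge \<sigma> 0) ^ (6 * k - 3)) {0..1}"
    using exact_form_over_edge[OF \<sigma>, of G "6 * k - 3"] by (simp add: split_beta)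
  have A: "((\<lambda>t. (case edge \<sigma> t of (x, y) \<Rightarrow> 1 / y) * ?v t) has_integral
      simplex_integral (\<lambda>(x, y). 1 / y) \<sigma>) {0..1}"
    unfolding simplex_integral_def
    using integrable_over_edge[OF \<sigma> holomorphic_on_const[of 1]]
    by (intro integrable_integral) (simp add: split_beta)
  have B: "((\<lambda>t. (case edge \<sigma> t of (x, y) \<Rightarrow> x / y) * ?v t) has_integral
      simplex_integral (\<lambda>(x, y). x / y) \<sigma>) {0..1}"
    unfolding simplex_integral_def
    using integrable_over_edge[OF \<sigma> holomorphic_on_ident]
    by (intro integrable_integral) (simp add: split_beta)
  have pointwise: "wkb a b (2 * k) (x, y) = \<alpha> / ?D * (1 / y) + \<beta> / ?D * (x / y) + 1 / ?D * ?E (x, y)"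
    if xy: "y ^ 2 = cubic a b x" "y \<noteq> 0" for x y
  proof -
    \<comment> \<open>With \<open>k = Suc l\<close> the subtractions in \<open>3 * k - 1\<close>,
      \<open>6 * k - 2\<close> and \<open>6 * k - 3\<close> are not truncated.\<close>
    obtain l where l: "k = Suc l" using k by (cases k) auto
    define e where "e = poly (pderiv G) x * cubic a b x - (of_nat (6 * k - 3) / 2) * poly G x * (3 * x ^ 2 + a)"
    have c: "of_nat (3 * k - 1) - 1 / 2 = of_nat (6 * k - 3) / (2 :: complex)"
      by (simp add: l field_simps)
    have "poly (smult ?D (wkb_poly a b (2 * k))) x =
        poly ([:\<alpha>, \<beta>:] * cubic_poly a b ^ (3 * k - 1) +
          exact_poly (of_nat (3 * k - 1) - 1 / 2) (cubic_poly a b) G) x"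
      unfolding red ..
    then have "?D * poly (wkb_poly a b (2 * k)) x = (\<alpha> + \<beta> * x) * cubic a b x ^ (3 * k - 1) + e"
      unfolding c by (simp add: exact_poly_def e_def poly_power algebra_simps add_divide_distrib)
    also have "cubic a b x ^ (3 * k - 1) = y ^ (6 * k - 2)"
      unfolding xy(1)[symmetric] power_mult[symmetric] by (simp add: diff_mult_distrib2)
    finally have P: "poly (wkb_poly a b (2 * k)) x = ((\<alpha> + \<beta> * x) * y ^ (6 * k - 2) + e) / ?D"
      using D by (simp add: field_simps)
    have y: "y ^ (3 * (2 * k)) = y ^ (6 * k - 2) * y * y" "y ^ (6 * k - 3 + 2) = y ^ (6 * k - 2) * y"
    proof -
      have "3 * (2 * k) = Suc (Suc (6 * k - 2))" "6 * k - 3 + 2 = Suc (6 * k - 2)"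
        by (simp_all add: l)
      then show "y ^ (3 * (2 * k)) = y ^ (6 * k - 2) * y * y" "y ^ (6 * k - 3 + 2) = y ^ (6 * k - 2) * y"
        by (simp_all only: power_Suc2)
    qed
    define Y where "Y = y ^ (6 * k - 2)"
    have Y: "Y \<noteq> 0" using xy(2) by (simp add: Y_def)
    define D' where "D' = ?D"
    have D': "D' \<noteq> 0" using D by (simp add: D'_def)
    have "?E (x, y) = e / (Y * y)"
      unfolding prod.case y(2) e_def Y_def ..
    then show ?thesis
      unfolding wkb_eq_wkb_poly[OF xy] P y(1) D'_def[symmetric] Y_def[symmetric]
      using xy(2) Y D' by (simp add: divide_simps) (simp add: algebra_simps)
  qed
  have "((\<lambda>t. wkb a b (2 * k) (edge \<sigma> t) * ?v t) has_integral
      \<alpha> / ?D * simplex_integral (\<lambda>(x, y). 1 / y) \<sigma> + \<beta> / ?D * simplex_integral (\<lambda>(x, y). x / y) \<sigma> +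
      1 / ?D * (poly G (fst (edge \<sigma> 1)) / snd (edge \<sigma> 1) ^ (6 * k - 3) -
        poly G (fst (edge \<sigma> 0)) / snd (edge \<sigma> 0) ^ (6 * k - 3))) {0..1}"
  proof (rule has_integral_eq[OF _ has_integral_add[OF has_integral_add[OF
          has_integral_mult_right[OF A, of "\<alpha> / ?D"] has_integral_mult_right[OF B, of "\<beta> / ?D"]]
          has_integral_mult_right[OF E, of "1 / ?D"]]])
    fix t assume t: "t \<in> {0..1::real}"
    obtain x y where xy: "edge \<sigma> t = (x, y)" by (cases "edge \<sigma> t")
    have "wkb a b (2 * k) (x, y) = \<alpha> / ?D * (1 / y) + \<beta> / ?D * (x / y) + 1 / ?D * ?E (x, y)"
      by (rule pointwise) (use edge_in_curve[OF \<sigma> t] edge_nonzero[OF \<sigma> t] xy in auto)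
    then show "\<alpha> / ?D * ((case edge \<sigma> t of (x, y) \<Rightarrow> 1 / y) * ?v t) +
        \<beta> / ?D * ((case edge \<sigma> t of (x, y) \<Rightarrow> x / y) * ?v t) + 1 / ?D * (?E (edge \<sigma> t) * ?v t) =
        wkb a b (2 * k) (edge \<sigma> t) * ?v t"
      unfolding xy prod.case by (simp only: ring_distribs mult.assoc)
  qed
  from integral_unique[OF this] show ?thesis
    unfolding simplex_integral_def[of "wkb a b (2 * k)"] H_def
    by (simp add: split_beta diff_divide_distrib)
qed

lemma Z_even_eq_periods:
  assumes c: "smooth_cycle a b c" and D: "disc a b \<noteq> 0" and k: "k \<ge> 1"
    and red: "smult (disc a b ^ (3 * k - 1)) (wkb_poly a b (2 * k)) =
       [:\<alpha>, \<beta>:] * cubic_poly a b ^ (3 * k - 1) +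
       exact_poly (of_nat (3 * k - 1) - 1 / 2) (cubic_poly a b) G"
  shows "Z (2 * k) a b c =
    \<alpha> / disc a b ^ (3 * k - 1) * A_period c + \<beta> / disc a b ^ (3 * k - 1) * B_period c"
proof -
  let ?H = "\<lambda>(x, y). poly G x / y ^ (6 * k - 3) / disc a b ^ (3 * k - 1)"
  have "Z (2 * k) a b c = linear_extension (\<lambda>\<sigma>.
      \<alpha> / disc a b ^ (3 * k - 1) * simplex_integral (\<lambda>(x, y). 1 / y) \<sigma> +
      \<beta> / disc a b ^ (3 * k - 1) * simplex_integral (\<lambda>(x, y). x / y) \<sigma> +
      (?H (edge \<sigma> 1) - ?H (edge \<sigma> 0))) c"
    unfolding Z_def chain_integral_linear_extension
    by (rule linear_extension_cong, rule simplex_integral_wkb_even[OF _ D k red])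
      (use c in \<open>auto simp: smooth_cycle_def\<close>)
  also have "\<dots> = \<alpha> / disc a b ^ (3 * k - 1) * A_period c + \<beta> / disc a b ^ (3 * k - 1) * B_period c"
    unfolding linear_extension_linear(1) linear_extension_linear(3)
      linear_extension_boundary[OF smooth_cycle_boundary[OF c]]
      A_period_def B_period_def chain_integral_linear_extension
    by simp
  finally show ?thesis .
qed

lemma weighted_homogeneous_divide_disc:
  assumes "homog (w + 6 * int m) f"
  shows "weighted_homogeneous w (\<lambda>a b. f a b / disc a b ^ m)"
  using assms unfolding homog_def weighted_homogeneous_def by blast

theorem proposition8p2:
  fixes k :: nat
  assumes "k \<ge> 1"
  shows "\<exists>\<alpha> \<beta>.
    weighted_homogeneous (3 - 5 * int k) \<alpha> \<and>
    weighted_homogeneous (2 - 5 * int k) \<beta> \<and>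
    (\<forall>a b. disc a b \<noteq> 0 \<longrightarrow>
      (\<forall>\<gamma>\<in>carrier (homology_group 1 (top_of_set (curve a b))).
         \<forall>c\<in>\<gamma>. smooth_cycle a b c \<longrightarrow>
           Z (2 * k) a b c = \<alpha> a b * A_period c + \<beta> a b * B_period c) \<and>
      (\<forall>\<Gamma>. locally_constant_at a b \<Gamma> \<longrightarrow>
         (\<lambda>a'. Z 0 a' b (\<Gamma> a' b)) field_differentiable at a \<and>
         (\<lambda>b'. Z 0 a b' (\<Gamma> a b')) field_differentiable at b \<and>
         Z (2 * k) a b (\<Gamma> a b) = D_op \<alpha> \<beta> (\<lambda>a' b'. Z 0 a' b' (\<Gamma> a' b')) a b))"
proof -
  have "homog_poly (4 * int k) (\<lambda>a b. wkb_poly a b (2 * k))"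
    using homog_poly_wkb_poly[of "2 * k"] by simp
  from reduce_pole[OF this, of "3 * k - 1"] obtain \<alpha>\<^sub>0 \<beta>\<^sub>0 G
    where \<alpha>\<^sub>0: "homog (4 * int k + 3 * int (3 * k - 1)) \<alpha>\<^sub>0"
      and \<beta>\<^sub>0: "homog (4 * int k + 3 * int (3 * k - 1) - 1) \<beta>\<^sub>0"
      and red: "\<forall>a b. smult (disc a b ^ (3 * k - 1)) (wkb_poly a b (2 * k)) =
        [:\<alpha>\<^sub>0 a b, \<beta>\<^sub>0 a b:] * cubic_poly a b ^ (3 * k - 1) +
        exact_poly (of_nat (3 * k - 1) - 1 / 2) (cubic_poly a b) (G a b)"
    by (elim exE conjE)
  define \<alpha> \<beta> where "\<alpha> = (\<lambda>a b. \<alpha>\<^sub>0 a b / disc a b ^ (3 * k - 1))"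
    and "\<beta> = (\<lambda>a b. \<beta>\<^sub>0 a b / disc a b ^ (3 * k - 1))"
  \<comment> \<open>Proved for each smooth cycle separately; the claim about homology classes and
    their representatives is an instance.\<close>
  have periods: "Z (2 * k) a b c = \<alpha> a b * A_period c + \<beta> a b * B_period c"
    if "disc a b \<noteq> 0" "smooth_cycle a b c" for a b c
    unfolding \<alpha>_def \<beta>_def by (rule Z_even_eq_periods[OF that(2,1) assms red[rule_format]])
  have "weighted_homogeneous (3 - 5 * int k) \<alpha>" "weighted_homogeneous (2 - 5 * int k) \<beta>"
  proof -
    \<comment> \<open>With \<open>m = 3 k - 1\<close> the power of the discriminant takes away
      \<open>6 m\<close>, and \<open>4 k + 3 m - 6 m = 3 - 5 k\<close>. The form
      \<open>x dx / y\<close> weighs 1 more than \<open>dx / y\<close>, so its coefficient weighs 1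
      less.\<close>
    have w: "4 * int k + 3 * int (3 * k - 1) = 3 - 5 * int k + 6 * int (3 * k - 1)"
      "4 * int k + 3 * int (3 * k - 1) - 1 = 2 - 5 * int k + 6 * int (3 * k - 1)"
      using assms by (simp_all add: of_nat_diff)
    show "weighted_homogeneous (3 - 5 * int k) \<alpha>"
      unfolding \<alpha>_def by (rule weighted_homogeneous_divide_disc[OF \<alpha>\<^sub>0[unfolded w(1)]])
    show "weighted_homogeneous (2 - 5 * int k) \<beta>"
      unfolding \<beta>_def by (rule weighted_homogeneous_divide_disc[OF \<beta>\<^sub>0[unfolded w(2)]])
  qed
  moreover have "(\<lambda>a'. Z 0 a' b (\<Gamma> a' b)) field_differentiable at a \<and>
      (\<lambda>b'. Z 0 a b' (\<Gamma> a b')) field_differentiable at b \<and>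
      Z (2 * k) a b (\<Gamma> a b) = D_op \<alpha> \<beta> (\<lambda>a' b'. Z 0 a' b' (\<Gamma> a' b')) a b"
    if "disc a b \<noteq> 0" and \<Gamma>: "locally_constant_at a b \<Gamma>" for a b \<Gamma>
  proof -
    have "smooth_cycle a b (\<Gamma> a b)"
      using \<Gamma> unfolding locally_constant_at_def by fast
    note Z_eq = periods[OF that(1) this] and partials = Z_0_partial_derivatives[OF \<Gamma>]
    have "Z (2 * k) a b (\<Gamma> a b) = D_op \<alpha> \<beta> (\<lambda>a' b'. Z 0 a' b' (\<Gamma> a' b')) a b"
      unfolding D_op_def Z_eq DERIV_imp_deriv[OF partials(1)] DERIV_imp_deriv[OF partials(2)]
      by simp
    then show ?thesis
      using partials unfolding field_differentiable_def by blast
  qed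
  ultimately show ?thesis using periods by blast
qed

end
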